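(* Let $V=(S,T)$ be a pure $p$-isopair of finite bimultiplicity with minimal polynomial $p$, and suppose $p=p_1p_2\cdots p_s$ is a product of distinct irreducible factors. Then for each $j\in\{1,\dots,s\}$ the dimension of $\ker(S-\lambda)^*\cap\ker(T-\mu)^*$ is a nonzero constant as $(\lambda,\mu)$ ranges over the points of $\mathfrak V(p_j)$ that are regular points for $p$.
   Context: Let $\mathbb D$, $\mathbb T$, $\mathbb E$ be the open unit disk, the unit circle, and the complement of the closed unit disk in $\mathbb C$. $Z(p)$ is the zero set of a polynomial $p$. A polynomial $p\in\mathbb C[z,w]$ is square free if no $q^2$ with $q$ non-constant divides $p$; it is inner toral if $Z(p)\subset \mathbb D^2\cup\mathbb T^2\cup\mathbb E^2$. Each irreducible factor $p_j$ of an inner toral polynomial is inner toral; put $\mathfrak V(p_j)=Z(p_j)\cap\mathbb D^2$. A point $(\lambda,\mu)\in\mathbb C^2$ is a regular point for $p$ if $(\lambda,\mu)\in Z(p)$ and $\nabla p(\lambda,\mu)=(\partial p/\partial z,\partial p/\partial w)|_{(\lambda,\mu)}\neq 0$. An isometry $S$ on a (complex) Hilbert space $H$ is pure if $\bigcap_{j\ge1}S^jH=\{0\}$; its multiplicity is $\operatorname{mult}(S)=\dim\ker(S^* )$. A pure isopair is a pair $V=(S,T)$ of commuting pure isometries on the same Hilbert space. For a nonzero polynomial $q$, $V$ is a pure $q$-isopair if $q(S,T)=0$; $V$ is algebraic if it is a pure $q$-isopair for some nonzero $q$. The bimultiplicity of $V$ is $(\operatorname{mult}(S),\operatorname{mult}(T))$;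 it is finite if both entries are. Minimal polynomial: for a pure algebraic isopair $V=(S,T)$ it is known that there is a square free inner toral polynomial $p$ with $p(S,T)=0$ such that $p$ divides every $q$ with $q(S,T)=0$; it is unique up to a nonzero constant factor and is called the minimal polynomial of $V$. *)

theory Defs
  imports
    "HOL-Analysis.Analysis"
    "HOL-Computational_Algebra.Computational_Algebra"
    "HOL-Library.Extended_Nat"
begin

text \<open>
  Complex Hilbert spaces. The inner product is linear in its first argument. That the form is
  positive definite is contained in \<open>cinner_norm\<close>, the norm being one already.
\<close>

class complex_inner = real_normed_vector +
  fixes scaleC :: "complex \<Rightarrow> 'a \<Rightarrow> 'a"  (infixr "*\<^sub>C" 75)
    and cinner :: "'a \<Rightarrow> 'a \<Rightarrow> complex"
  assumes scaleC_add_right: "c *\<^sub>C (x + y) = c *\<^sub>C x + c *\<^sub>C y"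
    and scaleC_add_left: "(c + d) *\<^sub>C x = c *\<^sub>C x + d *\<^sub>C x"
    and scaleC_scaleC: "c *\<^sub>C d *\<^sub>C x = (c * d) *\<^sub>C x"
    and scaleC_one: "1 *\<^sub>C x = x"
    and scaleR_scaleC: "r *\<^sub>R x = complex_of_real r *\<^sub>C x"
    and cinner_add_left: "cinner (x + y) z = cinner x z + cinner y z"
    and cinner_scaleC_left: "cinner (c *\<^sub>C x) y = c * cinner x y"
    and cinner_commute: "cinner y x = cnj (cinner x y)"
    and cinner_norm: "cinner x x = complex_of_real ((norm x)\<^sup>2)"

class complex_hilbert_space = complex_inner + complete_space

interpretation complex_vector: vector_space "scaleC :: complex \<Rightarrow> 'a \<Rightarrow> 'a::complex_inner"
  by unfold_locales (simp_all add: scaleC_add_right scaleC_add_left scaleC_scaleC scaleC_one)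

abbreviation clinear :: "('a::complex_inner \<Rightarrow> 'b::complex_inner) \<Rightarrow> bool" where
  "clinear \<equiv> Vector_Spaces.linear (*\<^sub>C) (*\<^sub>C)"

definition cdim :: "'a::complex_inner set \<Rightarrow> enat" where
  "cdim U = (if \<exists>B. finite B \<and> U \<subseteq> complex_vector.span B
             then enat (complex_vector.dim U) else \<infinity>)"

text \<open>For a bounded operator on a Hilbert space exactly one function has this property.\<close>

definition cadjoint :: "('a::complex_hilbert_space \<Rightarrow> 'a) \<Rightarrow> 'a \<Rightarrow> 'a" where
  "cadjoint A = (THE B. \<forall>x y. cinner (A x) y = cinner x (B y))"

definition ker :: "('a \<Rightarrow> 'b::zero) \<Rightarrow> 'a set" where
  "ker A = {x. A x = 0}"


definition isometry :: "('a::complex_hilbert_space \<Rightarrow> 'a) \<Rightarrow> bool" where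
  "isometry S \<longleftrightarrow> clinear S \<and> (\<forall>x. norm (S x) = norm x)"

definition pure_isometry :: "('a::complex_hilbert_space \<Rightarrow> 'a) \<Rightarrow> bool" where
  "pure_isometry S \<longleftrightarrow> isometry S \<and> (\<Inter>j\<in>{1..}. range (S ^^ j)) = {0}"

definition mult :: "('a::complex_hilbert_space \<Rightarrow> 'a) \<Rightarrow> enat" where
  "mult S = cdim (ker (cadjoint S))"

definition pure_isopair ::
  "('a::complex_hilbert_space \<Rightarrow> 'a) \<Rightarrow> ('a \<Rightarrow> 'a) \<Rightarrow> bool" where
  "pure_isopair S T \<longleftrightarrow> pure_isometry S \<and> pure_isometry T \<and> S \<circ> T = T \<circ> S"

definition finite_bimultiplicity ::
  "('a::complex_hilbert_space \<Rightarrow> 'a) \<Rightarrow> ('a \<Rightarrow> 'a) \<Rightarrow> bool" where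
  "finite_bimultiplicity S T \<longleftrightarrow> mult S \<noteq> \<infinity> \<and> mult T \<noteq> \<infinity>"


text \<open>
  The ring \<open>\<complex>[z,w]\<close> is represented as \<open>\<complex>[z][w]\<close>: the coefficient of \<open>z^i w^j\<close> in \<open>p\<close>
  is \<open>coeff (coeff p j) i\<close>. Its units are the nonzero constants, so the library's notions
  \<open>irreducible\<close> and \<open>squarefree\<close> are the usual ones.
\<close>

type_synonym bipoly = "complex poly poly"

definition eval2 :: "bipoly \<Rightarrow> complex \<Rightarrow> complex \<Rightarrow> complex" where
  "eval2 p z w = poly (poly p [:w:]) z"

definition partial_z :: "bipoly \<Rightarrow> bipoly" where
  "partial_z p = map_poly pderiv p"

definition partial_w :: "bipoly \<Rightarrow> bipoly" where
  "partial_w p = pderiv p"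

definition eval_op ::
  "bipoly \<Rightarrow> ('a::complex_hilbert_space \<Rightarrow> 'a) \<Rightarrow> ('a \<Rightarrow> 'a) \<Rightarrow> 'a \<Rightarrow> 'a" where
  "eval_op q S T x =
     (\<Sum>j\<le>degree q. \<Sum>i\<le>degree (coeff q j). coeff (coeff q j) i *\<^sub>C (S ^^ i) ((T ^^ j) x))"

definition zero_set :: "bipoly \<Rightarrow> (complex \<times> complex) set" where
  "zero_set p = {(z, w). eval2 p z w = 0}"

definition inner_toral :: "bipoly \<Rightarrow> bool" where
  "inner_toral p \<longleftrightarrow>
     zero_set p \<subseteq> ball 0 1 \<times> ball 0 1 \<union> sphere 0 1 \<times> sphere 0 1
                 \<union> (- cball 0 1) \<times> (- cball 0 1)"

definition inner_variety :: "bipoly \<Rightarrow> (complex \<times> complex) set" where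
  "inner_variety p = zero_set p \<inter> ball 0 1 \<times> ball 0 1"

definition regular_points :: "bipoly \<Rightarrow> (complex \<times> complex) set" where
  "regular_points p =
     {(z, w) \<in> zero_set p. (eval2 (partial_z p) z w, eval2 (partial_w p) z w) \<noteq> (0, 0)}"

definition pure_poly_isopair ::
  "bipoly \<Rightarrow> ('a::complex_hilbert_space \<Rightarrow> 'a) \<Rightarrow> ('a \<Rightarrow> 'a) \<Rightarrow> bool" where
  "pure_poly_isopair q S T \<longleftrightarrow> q \<noteq> 0 \<and> pure_isopair S T \<and> eval_op q S T = (\<lambda>x. 0)"

definition minimal_polynomial ::
  "bipoly \<Rightarrow> ('a::complex_hilbert_space \<Rightarrow> 'a) \<Rightarrow> ('a \<Rightarrow> 'a) \<Rightarrow> bool" where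
  "minimal_polynomial p S T \<longleftrightarrow>
     squarefree p \<and> inner_toral p \<and> eval_op p S T = (\<lambda>x. 0) \<and>
     (\<forall>q. eval_op q S T = (\<lambda>x. 0) \<longrightarrow> p dvd q)"

end

theory Submission
  imports "Jordan_Normal_Form.Determinant" "HOL-Computational_Algebra.Field_as_Ring" Defs
begin

text \<open>
  Let \<open>E(l, m)\<close> be the joint kernel of \<open>(S - l)\<^sup>*\<close> and \<open>(T - m)\<^sup>*\<close>, and let \<open>P\<close> be an irreducible
  factor of \<open>p\<close>. Algebra shows that \<open>dim E\<close> takes its least value \<open>r\<close> at all but finitely many
  points of the variety of \<open>P\<close>, and that \<open>r > 0\<close>. Analysis shows that near a regular point \<open>(a, b)\<close>
  there are infinitely many points of the variety where \<open>dim E\<close> is at least \<open>dim E(a, b)\<close>. Together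
  they give \<open>dim E(a, b) \<le> r\<close>, hence equality.

  The algebraic part. Because both multiplicities are finite, \<open>W = ker (S T)\<^sup>*\<close> is
  finite-dimensional, and by the Wold decomposition \<open>W\<close> is cyclic for the pure isometry \<open>S T\<close>.
  By an identity of Berger, Coburn and Lebow (\<open>wandering_relation\<close>), \<open>S\<close> and \<open>T\<close> map \<open>W\<close> into
  \<open>W + S T W\<close>. In coordinates of \<open>W\<close> the space \<open>E(l, m)\<close> is therefore the kernel of a matrix whose
  entries are polynomials in \<open>(l, m)\<close>. From a point of the variety where \<open>dim E\<close> has its least value
  \<open>r\<close>, a determinant yields a polynomial \<open>\<Delta>\<close> that does not vanish at this point but vanishes wherever
  \<open>dim E > r\<close> (\<open>dimension_jump_polynomial\<close>). As \<open>P\<close> is irreducible and does not divide \<open>\<Delta>\<close>, the two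
  have finitely many common zeros over the disk (\<open>inner_toral_finite_common_zeros\<close>). If \<open>r\<close>
  were \<open>0\<close>, Cramer's rule would give \<open>\<Delta>(S, T) = 0\<close>, so \<open>p\<close>, and with it \<open>P\<close>, would divide \<open>\<Delta>\<close>.

  The analytic part. By symmetry let \<open>\<partial>p/\<partial>w \<noteq> 0\<close> at \<open>(a, b)\<close>. A simple zero \<open>b\<close> of \<open>p(a, w)\<close> moves
  continuously to zeros \<open>m\<close> of \<open>p(l, w)\<close> for \<open>l\<close> near \<open>a\<close>. The operator \<open>p(l, T)\<^sup>*\<close> vanishes on
  \<open>ker (S - l)\<^sup>*\<close>, so the adjoint of \<open>p(l, w) / (w - m)\<close> at \<open>w = T\<close> maps this kernel into \<open>E(l, m)\<close>;
  at \<open>(a, b)\<close> it acts on \<open>E(a, b)\<close> as a nonzero scalar. Hence a basis of \<open>E(a, b)\<close> is moved to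
  independent vectors of \<open>E(l, m)\<close> (\<open>eigenspaces_near_regular_point\<close>).
\<close>

section \<open>Complex Hilbert spaces\<close>

lemma cinner_add_right: "cinner x (y + z) = cinner x y + cinner x z"
  by (metis cinner_add_left cinner_commute complex_cnj_add)

lemma cinner_scaleC_right: "cinner x (c *\<^sub>C y) = cnj c * cinner x y"
  by (metis cinner_scaleC_left cinner_commute complex_cnj_mult)

lemma cinner_zero_left [simp]: "cinner 0 x = 0"
  using cinner_add_left[of 0 0 x] by simp

lemma cinner_zero_right [simp]: "cinner x 0 = 0"
  using cinner_add_right[of x 0 0] by simp

lemma cinner_minus_left: "cinner (- x) y = - cinner x y"
  using cinner_add_left[of x "- x" y] by (simp add: add_eq_0_iff)

lemma cinner_minus_right: "cinner x (- y) = - cinner x y"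
  using cinner_add_right[of x y "- y"] by (simp add: add_eq_0_iff)

lemma cinner_diff_left: "cinner (x - y) z = cinner x z - cinner y z"
  using cinner_add_left[of x "- y" z] by (simp add: cinner_minus_left)

lemma cinner_diff_right: "cinner x (y - z) = cinner x y - cinner x z"
  using cinner_add_right[of x y "- z"] by (simp add: cinner_minus_right)

lemma cinner_sum_left: "cinner (\<Sum>i\<in>I. f i) y = (\<Sum>i\<in>I. cinner (f i) y)"
  by (induction I rule: infinite_finite_induct) (simp_all add: cinner_add_left)

lemma cinner_sum_right: "cinner y (\<Sum>i\<in>I. f i) = (\<Sum>i\<in>I. cinner y (f i))"
  by (induction I rule: infinite_finite_induct) (simp_all add: cinner_add_right)

lemma cinner_eq_0_self [simp]: "cinner x x = 0 \<longleftrightarrow> x = 0"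
  by (simp add: cinner_norm)

lemma norm_scaleC: "norm (c *\<^sub>C x) = cmod c * norm x"
proof -
  have "complex_of_real ((norm (c *\<^sub>C x))\<^sup>2) = complex_of_real ((cmod c * norm x)\<^sup>2)"
    unfolding cinner_norm[symmetric] cinner_scaleC_left cinner_scaleC_right
    by (simp add: cinner_norm power_mult_distrib complex_norm_square[symmetric] mult.commute)
  then have "(norm (c *\<^sub>C x))\<^sup>2 = (cmod c * norm x)\<^sup>2"
    by (simp only: of_real_eq_iff)
  then show ?thesis
    by (rule power2_eq_imp_eq) simp_all
qed

lemma norm_add_square: "(norm (x + y))\<^sup>2 = (norm x)\<^sup>2 + (norm y)\<^sup>2 + 2 * Re (cinner x y)"
proof -
  have "complex_of_real ((norm (x + y))\<^sup>2) = cinner (x + y) (x + y)"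
    by (rule cinner_norm[symmetric])
  also have "\<dots> = of_real ((norm x)\<^sup>2) + of_real ((norm y)\<^sup>2) + (cinner x y + cnj (cinner x y))"
    unfolding cinner_add_left cinner_add_right by (simp add: cinner_norm cinner_commute[of y x])
  also have "\<dots> = of_real ((norm x)\<^sup>2 + (norm y)\<^sup>2 + 2 * Re (cinner x y))"
    by (simp add: complex_add_cnj)
  finally show ?thesis
    by (simp only: of_real_eq_iff)
qed

lemma Cauchy_Schwarz: "cmod (cinner x y) \<le> norm x * norm y"
proof (cases "y = 0")
  case False
  define c where "c = cinner x y / of_real ((norm y)\<^sup>2)"
  have "cinner (x - c *\<^sub>C y) y = 0"
    using False by (simp add: cinner_diff_left cinner_scaleC_left cinner_norm c_def)
  then have "(norm ((x - c *\<^sub>C y) + c *\<^sub>C y))\<^sup>2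
      = (norm (x - c *\<^sub>C y))\<^sup>2 + (norm (c *\<^sub>C y))\<^sup>2"
    by (subst norm_add_square) (simp add: cinner_scaleC_right)
  then have "(norm (c *\<^sub>C y))\<^sup>2 \<le> (norm x)\<^sup>2"
    by simp
  then have "norm (c *\<^sub>C y) \<le> norm x"
    by (rule power2_le_imp_le) simp
  moreover have "norm (c *\<^sub>C y) = cmod (cinner x y) / norm y"
    using False by (simp add: norm_scaleC c_def norm_divide norm_mult power2_eq_square)
  ultimately show ?thesis
    using False by (simp add: field_simps)
qed simp

lemma scaleC_minus_left: "(- c) *\<^sub>C x = - (c *\<^sub>C (x :: 'a :: complex_inner))"
  by (rule complex_vector.scale_minus_left)

text \<open>The representing vector is the minimizer of \<open>\<parallel>x\<parallel>\<^sup>2 - 2 Re (f x)\<close>: by the parallelogram law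
  every minimizing sequence is Cauchy, and at the minimum the first variation vanishes.\<close>

lemma Riesz_representation:
  fixes f :: "'a::complex_hilbert_space \<Rightarrow> complex"
  assumes add: "\<And>x y. f (x + y) = f x + f y"
    and scale: "\<And>c x. f (c *\<^sub>C x) = c * f x"
    and bound: "\<And>x. cmod (f x) \<le> K * norm x"
  shows "\<exists>y. \<forall>x. f x = cinner x y"
proof -
  define g where "g x = (norm x)\<^sup>2 - 2 * Re (f x)" for x
  have lower: "- K\<^sup>2 \<le> g x" for x
  proof -
    have "Re (f x) \<le> K * norm x"
      using bound[of x] complex_Re_le_cmod[of "f x"] by linarith
    moreover have "0 \<le> (norm x - K)\<^sup>2"
      by simp
    ultimately show ?thesis
      unfolding g_def by (simp add: power2_diff algebra_simps)
  qed
  define m where "m = Inf (range g)"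
  have bdd: "bdd_below (range g)"
    using lower by (intro bdd_belowI2) auto
  have m_le: "m \<le> g x" for x
    unfolding m_def by (rule cInf_lower) (use bdd in auto)
  have "\<exists>x. g x < m + 1 / real (Suc n)" for n
  proof -
    have "Inf (range g) < m + 1 / real (Suc n)"
      by (simp add: m_def)
    then show ?thesis
      using cInf_lessD[of "range g"] by blast
  qed
  then obtain X where X: "\<And>n. g (X n) < m + 1 / real (Suc n)"
    by metis
  have f_diff: "f (x - y) = f x - f y" for x y
    using add[of "x - y" y] by simp
  have parallelogram: "(norm (x - y))\<^sup>2 \<le> 2 * (g x - m) + 2 * (g y - m)" for x y
  proof -
    define z where "z = (1/2) *\<^sub>C (x + y)"
    have 1: "(norm (x + y))\<^sup>2 + (norm (x - y))\<^sup>2 = 2 * (norm x)\<^sup>2 + 2 * (norm y)\<^sup>2"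
      using norm_add_square[of x y] norm_add_square[of x "- y"]
      by (simp add: cinner_minus_right)
    have "norm z = norm (x + y) / 2"
      by (simp add: z_def norm_scaleC)
    then have 2: "(norm z)\<^sup>2 = (norm (x + y))\<^sup>2 / 4"
      by (simp only: power_divide) simp
    have 3: "2 * Re (f z) = Re (f x) + Re (f y)"
      by (simp add: z_def scale add)
    show ?thesis
      using m_le[of z] 1 2 3 unfolding g_def by (simp add: algebra_simps)
  qed
  have "Cauchy X"
  proof (rule metric_CauchyI)
    fix e :: real
    assume "e > 0"
    then obtain N :: nat where N: "4 / e\<^sup>2 < real N"
      using reals_Archimedean2 by blast
    have Npos: "0 < real N"
      using N \<open>e > 0\<close> by (meson divide_pos_pos less_trans zero_less_numeral zero_less_power)
    have small: "g (X n) - m < e\<^sup>2 / 4" if "n \<ge> N" for n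
    proof -
      have "1 / real (Suc n) \<le> 1 / real N"
        using that Npos by (intro divide_left_mono) auto
      also have "\<dots> < e\<^sup>2 / 4"
        using N Npos \<open>e > 0\<close> by (simp add: field_simps)
      finally show ?thesis
        using X[of n] by linarith
    qed
    have "dist (X a) (X b) < e" if "a \<ge> N" "b \<ge> N" for a b
    proof -
      have "(norm (X a - X b))\<^sup>2 < e\<^sup>2"
        using parallelogram[of "X a" "X b"] add_strict_mono[OF small[OF that(1)] small[OF that(2)]]
        by (simp add: algebra_simps)
      then show ?thesis
        using \<open>e > 0\<close> by (simp add: dist_norm power2_less_imp_less)
    qed
    then show "\<exists>M. \<forall>a\<ge>M. \<forall>b\<ge>M. dist (X a) (X b) < e"
      by blast
  qed
  then obtain x where lim: "X \<longlonglongrightarrow> x"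
    using Cauchy_convergent convergent_def by blast
  have "(\<lambda>n. f (X n)) \<longlonglongrightarrow> f x"
  proof (rule Lim_transform_bound[where g = "\<lambda>n. K * norm (X n - x)", THEN LIM_zero_cancel])
    show "\<forall>\<^sub>F n in sequentially. norm (f (X n) - f x) \<le> norm (K * norm (X n - x))"
      using bound by (intro always_eventually allI)
        (metis abs_ge_self f_diff order_trans real_norm_def)
    have "(\<lambda>n. K * norm (X n - x)) \<longlonglongrightarrow> K * norm (x - x)"
      by (intro tendsto_intros lim)
    then show "(\<lambda>n. K * norm (X n - x)) \<longlonglongrightarrow> 0"
      by simp
  qed
  then have "(\<lambda>n. g (X n)) \<longlonglongrightarrow> g x"
    unfolding g_def by (intro tendsto_intros lim)
  moreover have "(\<lambda>n. m + 1 / real (Suc n)) \<longlonglongrightarrow> m + 0"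
    by (intro tendsto_intros LIMSEQ_inverse_real_of_nat[unfolded inverse_eq_divide])
  ultimately have "g x \<le> m + 0"
    by (rule LIMSEQ_le) (use X in \<open>auto intro: less_imp_le\<close>)
  have Re_eq: "Re (f h) = Re (cinner h x)" for h
  proof -
    define d where "d = Re (f h) - Re (cinner h x)"
    \<comment> \<open>a step \<open>t\<close> of the same sign as the first variation \<open>d\<close>, so small that the linear term
      dominates: the change of \<open>g\<close> is then at most \<open>- t d\<close>\<close>
    define t where "t = d / ((norm h)\<^sup>2 + 1)"
    have pos: "(norm h)\<^sup>2 + 1 > 0"
      by (simp add: add_nonneg_pos)
    have "g x \<le> g (x + of_real t *\<^sub>C h)"
      using \<open>g x \<le> m + 0\<close> m_le[of "x + of_real t *\<^sub>C h"] by linarith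
    moreover have "Re (cinner x h) = Re (cinner h x)"
      by (subst cinner_commute) simp
    ultimately have "0 \<le> t\<^sup>2 * (norm h)\<^sup>2 - 2 * t * d"
      unfolding g_def d_def
      by (simp add: norm_add_square norm_scaleC power_mult_distrib add scale cinner_scaleC_right
          algebra_simps)
    also have "\<dots> \<le> t\<^sup>2 * ((norm h)\<^sup>2 + 1) - 2 * t * d"
      by (simp add: distrib_left)
    also have "t\<^sup>2 * ((norm h)\<^sup>2 + 1) = t * d"
      using pos by (simp add: t_def power2_eq_square)
    finally have "t * d \<le> 0"
      by (simp add: algebra_simps)
    then have "d\<^sup>2 \<le> 0"
      using pos by (simp add: t_def power2_eq_square divide_le_0_iff)
    then show ?thesis
      by (simp add: d_def)
  qed
  have "f h = cinner h x" for h
  proof (rule complex_eqI)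
    show "Re (f h) = Re (cinner h x)"
      by (rule Re_eq)
    show "Im (f h) = Im (cinner h x)"
      using Re_eq[of "\<i> *\<^sub>C h"] by (simp add: scale cinner_scaleC_left)
  qed
  then show ?thesis
    by blast
qed

lemma clinear_add: "clinear A \<Longrightarrow> A (x + y) = A x + A y"
  by (simp add: Vector_Spaces.linear_iff)

lemma clinear_scaleC: "clinear A \<Longrightarrow> A (c *\<^sub>C x) = c *\<^sub>C A x"
  by (simp add: Vector_Spaces.linear_iff)

lemma clinear_zero: "clinear A \<Longrightarrow> A 0 = 0"
  using clinear_scaleC[of A 0 0] by simp

lemma clinear_diff: "clinear A \<Longrightarrow> A (x - y) = A x - A y"
  using clinear_add[of A "x - y" y] by simp

lemma clinear_sum: "clinear A \<Longrightarrow> A (\<Sum>i\<in>I. f i) = (\<Sum>i\<in>I. A (f i))"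
  by (induction I rule: infinite_finite_induct) (simp_all add: clinear_add clinear_zero)

lemma cinner_right_ext:
  assumes "\<And>x. cinner x y = cinner x z"
  shows "y = z"
  using assms[of "y - z"] cinner_eq_0_self[of "y - z"] by (simp add: cinner_diff_right)

lemma cadjoint_bounded:
  fixes A :: "'a::complex_hilbert_space \<Rightarrow> 'a"
  assumes lin: "clinear A" and bound: "\<And>x. norm (A x) \<le> K * norm x"
  shows "cinner (A x) y = cinner x (cadjoint A y)"
proof -
  have "\<exists>z. \<forall>x. cinner (A x) y = cinner x z" for y
  proof (rule Riesz_representation)
    show "cmod (cinner (A x) y) \<le> (K * norm y) * norm x" for x
      using Cauchy_Schwarz[of "A x" y] mult_right_mono[OF bound[of x] norm_ge_zero[of y]]
      by (simp add: mult_ac)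
  qed (simp_all add: lin clinear_add clinear_scaleC cinner_add_left cinner_scaleC_left)
  then obtain B where B: "\<And>x y. cinner (A x) y = cinner x (B y)"
    by metis
  have "cadjoint A = B"
    unfolding cadjoint_def
  proof (rule the_equality)
    show "C = B" if "\<forall>x y. cinner (A x) y = cinner x (C y)" for C
      using that B by (intro ext cinner_right_ext) metis
  qed (simp add: B)
  then show ?thesis
    using B by simp
qed

lemma ker_cadjoint_bounded:
  fixes A :: "'a::complex_hilbert_space \<Rightarrow> 'a"
  assumes "clinear A" "\<And>x. norm (A x) \<le> K * norm x"
  shows "ker (cadjoint A) = {y. \<forall>x. cinner (A x) y = 0}"
  unfolding ker_def cadjoint_bounded[OF assms]
  using cinner_right_ext[of "cadjoint A _" 0] by auto

subsection \<open>Orthonormal sets\<close>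

text \<open>Finiteness is included because only bases of finite-dimensional subspaces occur.\<close>

definition orthonormal :: "'a::complex_inner set \<Rightarrow> bool" where
  "orthonormal B \<longleftrightarrow> finite B \<and> (\<forall>x\<in>B. \<forall>y\<in>B. cinner x y = (if x = y then 1 else 0))"

lemma orthonormal_coefficient:
  assumes "orthonormal B" "b \<in> B"
  shows "cinner (\<Sum>x\<in>B. c x *\<^sub>C x) b = c b"
proof -
  have "cinner (\<Sum>x\<in>B. c x *\<^sub>C x) b = (\<Sum>x\<in>B. if x = b then c x else 0)"
    unfolding cinner_sum_left
    by (rule sum.cong) (use assms in \<open>auto simp: cinner_scaleC_left orthonormal_def\<close>)
  also have "\<dots> = c b"
    using assms by (simp add: orthonormal_def)
  finally show ?thesis .
qed

lemma orthonormal_independent: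
  assumes "orthonormal B"
  shows "complex_vector.independent B"
proof (rule complex_vector.independent_if_scalars_zero)
  show "c b = 0" if "(\<Sum>x\<in>B. c x *\<^sub>C x) = 0" "b \<in> B" for c b
    using orthonormal_coefficient[OF assms that(2), of c] that(1) by simp
qed (use assms in \<open>simp add: orthonormal_def\<close>)

lemma orthonormal_expansion:
  assumes "orthonormal B" "x \<in> complex_vector.span B"
  shows "x = (\<Sum>b\<in>B. cinner x b *\<^sub>C b)"
proof -
  obtain c where c: "x = (\<Sum>b\<in>B. c b *\<^sub>C b)"
    using assms complex_vector.span_finite[of B] by (auto simp: orthonormal_def)
  then show ?thesis
    using orthonormal_coefficient[OF assms(1)] by simp
qed

lemma orthonormal_insert_normalized:
  assumes B: "orthonormal B" and z: "z \<noteq> 0" "\<And>b. b \<in> B \<Longrightarrow> cinner z b = 0"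
  shows "orthonormal (insert ((1 / of_real (norm z)) *\<^sub>C z) B)"
    "(1 / of_real (norm z)) *\<^sub>C z \<notin> B"
proof -
  let ?u = "(1 / of_real (norm z)) *\<^sub>C z"
  have u: "cinner ?u ?u = 1"
    using z(1) unfolding cinner_scaleC_left cinner_scaleC_right
    by (simp add: cinner_norm power2_eq_square)
  have ub: "cinner ?u b = 0" "cinner b ?u = 0" if "b \<in> B" for b
    using z(2)[OF that] cinner_commute[of b z]
    by (simp_all add: cinner_scaleC_left cinner_scaleC_right)
  show "?u \<notin> B"
    using u ub by force
  then show "orthonormal (insert ?u B)"
    using B u ub by (auto simp: orthonormal_def)
qed

text \<open>An orthonormal subset of maximal size spans, since otherwise the residual of a vector
  outside its span could be normalized and added.\<close>

lemma orthonormal_basis_exists: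
  assumes E: "complex_vector.subspace E" and fin: "finite F" "E \<subseteq> complex_vector.span F"
  obtains B where "orthonormal B" "complex_vector.span B = E" "card B = complex_vector.dim E"
proof -
  define P where "P n \<longleftrightarrow> (\<exists>B. orthonormal B \<and> B \<subseteq> E \<and> card B = n)" for n
  have "P 0"
    unfolding P_def by (rule exI[of _ "{}"]) (simp add: orthonormal_def)
  moreover have bound: "n \<le> card F" if "P n" for n
    using that fin complex_vector.independent_span_bound[OF fin(1)] orthonormal_independent
    unfolding P_def by (metis subset_trans)
  ultimately obtain n where n: "P n" "\<And>k. P k \<Longrightarrow> k \<le> n"
    using GreatestI_nat[of P 0 "card F"] Greatest_le_nat[of P _ "card F"] by metis
  from n(1) obtain B where B: "orthonormal B" "B \<subseteq> E" "card B = n"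
    unfolding P_def by blast
  have "E \<subseteq> complex_vector.span B"
  proof
    fix x
    assume x: "x \<in> E"
    define y where "y = (\<Sum>b\<in>B. cinner x b *\<^sub>C b)"
    have y: "y \<in> complex_vector.span B"
      unfolding y_def
      by (intro complex_vector.span_sum complex_vector.span_scale complex_vector.span_base)
    have yE: "y \<in> E"
      using y complex_vector.span_minimal[OF B(2) E] by blast
    have "x - y = 0"
    proof (rule ccontr)
      assume nz: "x - y \<noteq> 0"
      have orth: "cinner (x - y) b = 0" if "b \<in> B" for b
        using orthonormal_coefficient[OF B(1) that, of "cinner x"]
        by (simp add: cinner_diff_left y_def)
      let ?u = "(1 / of_real (norm (x - y))) *\<^sub>C (x - y)"
      have "?u \<in> E"
        by (intro complex_vector.subspace_scale complex_vector.subspace_diff E x yE)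
      then have "P (Suc n)"
        unfolding P_def using orthonormal_insert_normalized[OF B(1) nz orth] B
        by (intro exI[of _ "insert ?u B"]) (auto simp: orthonormal_def card_insert_if)
      then show False
        using n(2) by fastforce
    qed
    then show "x \<in> complex_vector.span B"
      using y by simp
  qed
  moreover have "complex_vector.span B \<subseteq> E"
    by (rule complex_vector.span_minimal[OF B(2) E])
  ultimately have "complex_vector.span B = E"
    by blast
  moreover have "card B = complex_vector.dim E"
    using complex_vector.dim_span_eq_card_independent[OF orthonormal_independent[OF B(1)]]
      calculation by simp
  ultimately show thesis
    using that B(1) by blast
qed

text \<open>Linear independence is an open condition: comparing with the coefficient of largest
  modulus shows that small perturbations of an orthonormal set stay independent.\<close>

lemma perturbed_orthonormal_dim:
  fixes f :: "'a::complex_inner \<Rightarrow> 'a"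
  assumes B: "orthonormal B"
    and near: "\<And>b. b \<in> B \<Longrightarrow> norm (f b - b) < 1 / (real (card B) + 1)"
    and E: "f ` B \<subseteq> E" "finite F" "E \<subseteq> complex_vector.span F"
  shows "card B \<le> complex_vector.dim E"
proof -
  have finB: "finite B"
    using B by (simp add: orthonormal_def)
  have nb: "norm b = 1" if "b \<in> B" for b
  proof -
    have "complex_of_real ((norm b)\<^sup>2) = complex_of_real 1"
      unfolding cinner_norm[symmetric] using B that by (simp add: orthonormal_def)
    then have "(norm b)\<^sup>2 = 1"
      by (simp only: of_real_eq_iff)
    then show ?thesis
      by (metis norm_ge_zero one_power2 power2_eq_imp_eq zero_le_one)
  qed
  have zero: "c b = 0" if rel: "(\<Sum>b\<in>B. c b *\<^sub>C f b) = 0" and b: "b \<in> B" for c b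
  proof -
    obtain k where k: "k \<in> B" "\<And>x. x \<in> B \<Longrightarrow> cmod (c x) \<le> cmod (c k)"
    proof -
      have "Max ((\<lambda>x. cmod (c x)) ` B) \<in> (\<lambda>x. cmod (c x)) ` B"
        using finB b by (intro Max_in) auto
      then obtain k where "k \<in> B" "Max ((\<lambda>x. cmod (c x)) ` B) = cmod (c k)"
        by blast
      then show thesis
        using that finB by (metis Max_ge finite_imageI image_eqI)
    qed
    let ?n = "real (card B)"
    have "0 = cinner (\<Sum>x\<in>B. c x *\<^sub>C x) k + cinner (\<Sum>x\<in>B. c x *\<^sub>C (f x - x)) k"
      unfolding cinner_add_left[symmetric] sum.distrib[symmetric] scaleC_add_right[symmetric]
      by (simp add: rel)
    then have "c k = - cinner (\<Sum>x\<in>B. c x *\<^sub>C (f x - x)) k"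
      by (simp add: orthonormal_coefficient[OF B k(1)] eq_neg_iff_add_eq_0)
    then have "cmod (c k) \<le> norm (\<Sum>x\<in>B. c x *\<^sub>C (f x - x))"
      using Cauchy_Schwarz[of "\<Sum>x\<in>B. c x *\<^sub>C (f x - x)" k] nb[OF k(1)] by simp
    also have "\<dots> \<le> (\<Sum>x\<in>B. cmod (c x) * norm (f x - x))"
      by (rule order_trans[OF norm_sum]) (simp add: norm_scaleC)
    also have "\<dots> \<le> (\<Sum>x\<in>B. cmod (c k) * (1 / (?n + 1)))"
      by (intro sum_mono mult_mono) (use k near in \<open>auto intro: less_imp_le\<close>)
    also have "\<dots> = cmod (c k) * (?n / (?n + 1))"
      by simp
    finally have "cmod (c k) * (1 / (?n + 1)) \<le> 0"
      by (simp add: field_simps)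
    then have "cmod (c k) \<le> 0"
      by (simp add: mult_le_0_iff divide_le_0_iff)
    then show ?thesis
      using k(2)[OF b] by simp
  qed
  have inj: "inj_on f B"
  proof (rule inj_onI, rule ccontr)
    fix x y
    assume xy: "x \<in> B" "y \<in> B" "f x = f y" "x \<noteq> y"
    define c :: "'a \<Rightarrow> complex" where "c z = (if z = x then 1 else if z = y then -1 else 0)" for z
    have "(\<Sum>b\<in>B. c b *\<^sub>C f b) = (\<Sum>b\<in>{x, y}. c b *\<^sub>C f b)"
      by (rule sum.mono_neutral_right) (use xy finB in \<open>auto simp: c_def\<close>)
    also have "\<dots> = 0"
      using xy by (simp add: c_def)
    finally have "c x = 0"
      using zero xy(1) by blast
    then show False
      by (simp add: c_def)
  qed
  have "complex_vector.independent (f ` B)"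
  proof (rule complex_vector.independent_if_scalars_zero)
    fix c x
    assume "(\<Sum>x\<in>f ` B. c x *\<^sub>C x) = 0" "x \<in> f ` B"
    then show "c x = 0"
      using zero[of "\<lambda>b. c (f b)"] inj by (auto simp: sum.reindex)
  qed (use finB in auto)
  moreover have "f ` B \<subseteq> complex_vector.span (f ` B)"
    by (rule complex_vector.span_superset)
  moreover obtain C where C: "C \<subseteq> E" "complex_vector.independent C" "E \<subseteq> complex_vector.span C"
      "card C = complex_vector.dim E"
    by (rule complex_vector.basis_exists)
  moreover have "finite C"
    using complex_vector.independent_span_bound[OF E(2) C(2)] C(1) E(3) by blast
  ultimately have "card (f ` B) \<le> complex_vector.dim E"
    using complex_vector.independent_span_bound[of C "f ` B"] E(1) by (metis subset_trans)
  then show ?thesis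
    by (simp add: card_image inj)
qed

text \<open>Orthogonality to \<open>card G\<close> vectors imposes at most \<open>card G\<close> linear conditions: the orthogonal
  projection onto the span of \<open>G\<close> cannot be injective on a space of larger dimension.\<close>

lemma exists_orthogonal_vector:
  assumes E: "complex_vector.subspace E" and fin: "finite F" "E \<subseteq> complex_vector.span F"
    and G: "finite G" "card G < complex_vector.dim E"
  obtains h where "h \<in> E" "h \<noteq> 0" "\<And>g. g \<in> G \<Longrightarrow> cinner h g = 0"
proof -
  obtain U where U: "orthonormal U" "complex_vector.span U = complex_vector.span G"
    by (rule orthonormal_basis_exists[OF complex_vector.subspace_span G(1) order_refl])
  define P where "P x = (\<Sum>u\<in>U. cinner x u *\<^sub>C u)" for x
  have lin: "clinear P"
    unfolding P_def Vector_Spaces.linear_iff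
    by (simp add: cinner_add_left scaleC_add_left sum.distrib cinner_scaleC_left scaleC_scaleC
        complex_vector.scale_sum_right complex_vector.vector_space_axioms)
  have range: "P x \<in> complex_vector.span G" for x
    unfolding U(2)[symmetric] P_def
    by (intro complex_vector.span_sum complex_vector.span_scale complex_vector.span_base)
  obtain C where C: "orthonormal C" "complex_vector.span C = E" "card C = complex_vector.dim E"
    by (rule orthonormal_basis_exists[OF E fin])
  interpret pair: vector_space_pair "scaleC :: complex \<Rightarrow> 'a \<Rightarrow> 'a" "scaleC :: complex \<Rightarrow> 'a \<Rightarrow> 'a"
    by unfold_locales
  have "\<not> inj_on P E"
  proof
    assume "inj_on P E"
    then have "complex_vector.independent (P ` C)"
      using pair.linear_independent_injective_image[OF lin orthonormal_independent[OF C(1)]] C(2)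
      by simp
    then have "card (P ` C) \<le> card G"
      using complex_vector.independent_span_bound[OF G(1)] range by blast
    moreover have "card (P ` C) = card C"
      using \<open>inj_on P E\<close> C(2) complex_vector.span_superset[of C]
      by (intro card_image) (auto intro: inj_on_subset)
    ultimately show False
      using G(2) C(3) by simp
  qed
  then obtain x y where xy: "x \<in> E" "y \<in> E" "x \<noteq> y" "P x = P y"
    by (auto simp: inj_on_def)
  define h where "h = x - y"
  have "P h = 0"
    using xy(4) lin by (simp add: h_def clinear_diff)
  then have hu: "cinner h u = 0" if "u \<in> U" for u
    using orthonormal_coefficient[OF U(1) that, of "cinner h"] by (simp add: P_def)
  have "cinner h g = 0" if "g \<in> G" for g
  proof -
    have "g \<in> complex_vector.span U"
      using that U(2) complex_vector.span_base by auto
    then show ?thesis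
      using orthonormal_expansion[OF U(1), of g] hu
      by (metis (no_types, lifting) cinner_scaleC_right cinner_sum_right mult_zero_right sum.neutral)
  qed
  moreover have "h \<in> E" "h \<noteq> 0"
    using xy E by (auto simp: h_def complex_vector.subspace_diff)
  ultimately show thesis
    using that by blast
qed

section \<open>Isometries, their adjoints and resolvents\<close>

lemma isometry_clinear: "isometry A \<Longrightarrow> clinear A"
  by (simp add: isometry_def)

lemma isometry_norm: "isometry A \<Longrightarrow> norm (A x) = norm x"
  by (simp add: isometry_def)

lemma isometry_cadjoint: "isometry A \<Longrightarrow> cinner (A x) y = cinner x (cadjoint A y)"
  using cadjoint_bounded[of A 1] by (simp add: isometry_def)

lemma isometry_cadjoint': "isometry A \<Longrightarrow> cinner y (A x) = cinner (cadjoint A y) x"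
  using isometry_cadjoint[of A x y] by (metis cinner_commute)

lemma cadjoint_isometry_clinear:
  assumes "isometry A"
  shows "clinear (cadjoint A)"
proof -
  have "cadjoint A (x + y) = cadjoint A x + cadjoint A y" for x y
    by (rule cinner_right_ext) (simp add: cinner_add_right flip: isometry_cadjoint[OF assms])
  moreover have "cadjoint A (c *\<^sub>C x) = c *\<^sub>C cadjoint A x" for c x
    by (rule cinner_right_ext) (simp add: cinner_scaleC_right flip: isometry_cadjoint[OF assms])
  ultimately show ?thesis
    by (simp add: Vector_Spaces.linear_iff complex_vector.vector_space_axioms)
qed

lemma isometry_cinner:
  assumes "isometry A"
  shows "cinner (A x) (A y) = cinner x y"
proof -
  note lin = isometry_clinear[OF assms]
  have Re_eq: "Re (cinner (A x) (A y)) = Re (cinner x y)" for x y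
    using norm_add_square[of x y] norm_add_square[of "A x" "A y"]
    by (simp add: isometry_norm[OF assms] flip: clinear_add[OF lin])
  show ?thesis
  proof (rule complex_eqI)
    show "Im (cinner (A x) (A y)) = Im (cinner x y)"
      using Re_eq[of x "\<i> *\<^sub>C y"] by (simp add: clinear_scaleC[OF lin] cinner_scaleC_right)
  qed (rule Re_eq)
qed

lemma cadjoint_isometry_cancel:
  assumes "isometry A"
  shows "cadjoint A (A x) = x"
  by (rule cinner_right_ext)
    (simp add: isometry_cinner[OF assms] flip: isometry_cadjoint[OF assms])

lemma norm_cadjoint_isometry:
  assumes "isometry A"
  shows "norm (cadjoint A x) \<le> norm x"
proof (cases "cadjoint A x = 0")
  case False
  have "complex_of_real ((norm (cadjoint A x))\<^sup>2) = cinner (A (cadjoint A x)) x"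
    by (simp add: isometry_cadjoint[OF assms] cinner_norm)
  then have "(norm (cadjoint A x))\<^sup>2 = cmod (cinner (A (cadjoint A x)) x)"
    by (metis abs_of_nonneg norm_of_real zero_le_power2)
  also have "\<dots> \<le> norm (cadjoint A x) * norm x"
    using Cauchy_Schwarz by (metis isometry_norm[OF assms])
  finally show ?thesis
    using False by (simp add: power2_eq_square)
qed simp

lemma isometry_compose:
  assumes "isometry A" "isometry B"
  shows "isometry (A \<circ> B)"
  using assms unfolding isometry_def
  by (simp add: Vector_Spaces.linear_iff)

lemma cadjoint_compose:
  assumes "isometry A" "isometry B"
  shows "cadjoint (A \<circ> B) x = cadjoint B (cadjoint A x)"
  using isometry_cadjoint[OF isometry_compose[OF assms], of _ x]
  by (intro cinner_right_ext) (simp add: isometry_cadjoint assms)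

text \<open>The operator \<open>(1 - a A)\<^sup>-\<^sup>1\<close>.\<close>

definition resolvent :: "('a::complex_hilbert_space \<Rightarrow> 'a) \<Rightarrow> complex \<Rightarrow> 'a \<Rightarrow> 'a" where
  "resolvent A a x = (SOME y. y - a *\<^sub>C A y = x)"

lemma isometry_resolvent_lower_bound:
  assumes "isometry A"
  shows "(1 - cmod a) * norm y \<le> norm (y - a *\<^sub>C A y)"
  using norm_triangle_ineq2[of y "a *\<^sub>C A y"]
  by (simp add: norm_scaleC isometry_norm[OF assms] left_diff_distrib)

text \<open>For \<open>\<bar>a\<bar> < 1\<close> the map \<open>y \<mapsto> x + a A y\<close> is a contraction, so it has a fixed point.\<close>

lemma resolvent_eq:
  assumes A: "isometry A" and a: "cmod a < 1"
  shows "resolvent A a x - a *\<^sub>C A (resolvent A a x) = x"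
proof -
  have "\<exists>!y\<in>UNIV. x + a *\<^sub>C A y = y"
  proof (rule Banach_fix)
    show "dist (x + a *\<^sub>C A y) (x + a *\<^sub>C A z) \<le> cmod a * dist y z" for y z
      by (simp add: dist_norm norm_scaleC isometry_norm[OF A]
          flip: complex_vector.scale_right_diff_distrib clinear_diff[OF isometry_clinear[OF A]])
  qed (use a in \<open>simp_all add: complete_UNIV\<close>)
  then obtain y where "x + a *\<^sub>C A y = y"
    by blast
  then have "y - a *\<^sub>C A y = x"
    by (simp add: diff_eq_eq)
  then show ?thesis
    unfolding resolvent_def by (rule someI)
qed

lemma resolvent_unique:
  assumes A: "isometry A" and a: "cmod a < 1" and y: "y - a *\<^sub>C A y = x"
  shows "y = resolvent A a x"
proof -
  let ?z = "resolvent A a x"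
  have "(y - ?z) - a *\<^sub>C A (y - ?z) = (y - a *\<^sub>C A y) - (?z - a *\<^sub>C A ?z)"
    by (simp add: clinear_diff[OF isometry_clinear[OF A]] complex_vector.scale_right_diff_distrib)
  also have "\<dots> = 0"
    unfolding y resolvent_eq[OF A a] by simp
  finally have "(1 - cmod a) * norm (y - ?z) \<le> 0"
    using isometry_resolvent_lower_bound[OF A, of a "y - ?z"] by simp
  then show ?thesis
    using a by (simp add: mult_le_0_iff)
qed

lemma resolvent_clinear:
  assumes A: "isometry A" and a: "cmod a < 1"
  shows "clinear (resolvent A a)"
proof -
  note lin = isometry_clinear[OF A]
  note eq = resolvent_eq[OF A a]
  have "resolvent A a (x + y) = resolvent A a x + resolvent A a y" for x y
  proof (rule resolvent_unique[OF A a, symmetric])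
    have "(resolvent A a x + resolvent A a y) - a *\<^sub>C A (resolvent A a x + resolvent A a y)
        = (resolvent A a x - a *\<^sub>C A (resolvent A a x)) + (resolvent A a y - a *\<^sub>C A (resolvent A a y))"
      by (simp add: clinear_add[OF lin] scaleC_add_right)
    then show "(resolvent A a x + resolvent A a y) - a *\<^sub>C A (resolvent A a x + resolvent A a y) = x + y"
      by (simp only: eq)
  qed
  moreover have "resolvent A a (c *\<^sub>C x) = c *\<^sub>C resolvent A a x" for c x
  proof (rule resolvent_unique[OF A a, symmetric])
    have "c *\<^sub>C resolvent A a x - a *\<^sub>C A (c *\<^sub>C resolvent A a x)
        = c *\<^sub>C (resolvent A a x - a *\<^sub>C A (resolvent A a x))"
      by (simp add: clinear_scaleC[OF lin] complex_vector.scale_right_diff_distrib mult.commute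
          scaleC_scaleC)
    then show "c *\<^sub>C resolvent A a x - a *\<^sub>C A (c *\<^sub>C resolvent A a x) = c *\<^sub>C x"
      by (simp only: eq)
  qed
  ultimately show ?thesis
    by (simp add: Vector_Spaces.linear_iff complex_vector.vector_space_axioms)
qed

lemma resolvent_tendsto:
  assumes A: "isometry A" and a: "cmod a < 1" and lim: "(f \<longlongrightarrow> a) F"
  shows "((\<lambda>n. resolvent A (f n) x) \<longlongrightarrow> resolvent A a x) F"
proof -
  let ?y = "resolvent A a x"
  have ev: "\<forall>\<^sub>F n in F. cmod (f n) < 1"
    using order_tendstoD(2)[OF tendsto_norm[OF lim] a] .
  have "((\<lambda>n. cmod (f n - a) * norm ?y / (1 - cmod (f n))) \<longlongrightarrow> cmod (a - a) * norm ?y / (1 - cmod a)) F"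
    by (intro tendsto_intros lim) (use a in auto)
  then have zero: "((\<lambda>n. cmod (f n - a) * norm ?y / (1 - cmod (f n))) \<longlongrightarrow> 0) F"
    by simp
  have "((\<lambda>n. resolvent A (f n) x - ?y) \<longlongrightarrow> 0) F"
  proof (rule Lim_null_comparison[OF _ zero])
    show "\<forall>\<^sub>F n in F. norm (resolvent A (f n) x - ?y) \<le> cmod (f n - a) * norm ?y / (1 - cmod (f n))"
      using ev
    proof eventually_elim
      case (elim n)
      let ?z = "resolvent A (f n) x"
      have "(?z - ?y) - f n *\<^sub>C A (?z - ?y) = (?z - f n *\<^sub>C A ?z) - (?y - a *\<^sub>C A ?y) + (f n - a) *\<^sub>C A ?y"
        by (simp add: clinear_diff[OF isometry_clinear[OF A]] complex_vector.scale_right_diff_distrib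
            complex_vector.scale_left_diff_distrib)
      also have "\<dots> = (f n - a) *\<^sub>C A ?y"
        unfolding resolvent_eq[OF A elim] resolvent_eq[OF A a] by simp
      finally have "(1 - cmod (f n)) * norm (?z - ?y) \<le> cmod (f n - a) * norm ?y"
        using isometry_resolvent_lower_bound[OF A, of "f n" "?z - ?y"]
        by (simp add: norm_scaleC isometry_norm[OF A])
      then show ?case
        using elim by (simp add: field_simps)
    qed
  qed
  then show ?thesis
    by (rule LIM_zero_cancel)
qed

text \<open>The eigenvectors of \<open>A\<^sup>*\<close> for \<open>a\<close> are obtained from \<open>ker A\<^sup>*\<close> by the resolvent; on the
  Hardy space these are the multiples of the reproducing kernels.\<close>

lemma resolvent_eigenvector:
  assumes A: "isometry A" and a: "cmod a < 1" and x: "cadjoint A x = 0"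
  shows "cadjoint A (resolvent A a x) = a *\<^sub>C resolvent A a x"
proof -
  note lin = cadjoint_isometry_clinear[OF A]
  have "cadjoint A (resolvent A a x - a *\<^sub>C A (resolvent A a x)) = 0"
    by (simp only: resolvent_eq[OF A a] x)
  then show ?thesis
    by (simp add: clinear_diff[OF lin] clinear_scaleC[OF lin] cadjoint_isometry_cancel[OF A])
qed

lemma eigenvector_residual:
  assumes A: "isometry A" and h: "cadjoint A h = a *\<^sub>C h"
  shows "cadjoint A (h - a *\<^sub>C A h) = 0"
proof -
  note lin = cadjoint_isometry_clinear[OF A]
  show ?thesis
    by (simp add: clinear_diff[OF lin] clinear_scaleC[OF lin] cadjoint_isometry_cancel[OF A] h)
qed

lemma funpow_clinear:
  fixes A :: "'a::complex_inner \<Rightarrow> 'a"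
  assumes "clinear A"
  shows "clinear (A ^^ n)"
  by (induction n) (use assms in \<open>auto simp: Vector_Spaces.linear_iff\<close>)

lemma cinner_funpow_cadjoint:
  assumes "isometry A"
  shows "cinner ((A ^^ n) x) y = cinner x ((cadjoint A ^^ n) y)"
  by (induction n arbitrary: x y) (simp_all add: isometry_cadjoint[OF assms] funpow_swap1)

lemma cinner_funpow_eigenvector:
  assumes "isometry A" "cadjoint A h = cnj l *\<^sub>C h"
  shows "cinner ((A ^^ n) x) h = l ^ n * cinner x h"
  by (induction n) (simp_all add: isometry_cadjoint assms cinner_scaleC_right)

text \<open>The Wold decomposition of a pure isometry, in the form that \<open>ker A\<^sup>*\<close> is a cyclic subspace:
  a vector orthogonal to all \<open>A\<^sup>n d\<close> with \<open>d \<in> ker A\<^sup>*\<close> lies in the range of every \<open>A\<^sup>n\<close>,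
  because \<open>A A\<^sup>*\<close> fixes the orthogonal complement of \<open>ker A\<^sup>*\<close>.\<close>

lemma pure_isometry_cyclic:
  assumes pure: "pure_isometry A"
    and orth: "\<And>n d. cadjoint A d = 0 \<Longrightarrow> cinner ((A ^^ n) d) x = 0"
  shows "x = 0"
proof -
  have A: "isometry A"
    using pure by (simp add: pure_isometry_def)
  have step: "A (cadjoint A y) = y" if y: "\<And>d. cadjoint A d = 0 \<Longrightarrow> cinner d y = 0" for y
  proof -
    define z where "z = y - A (cadjoint A y)"
    have z: "cadjoint A z = 0"
      by (simp add: z_def clinear_diff[OF cadjoint_isometry_clinear[OF A]]
          cadjoint_isometry_cancel[OF A])
    have "cinner z (A (cadjoint A y)) = 0"
      by (simp add: isometry_cadjoint'[OF A] z)
    then have "cinner z z = 0"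
      using y[OF z] by (subst (2) z_def) (simp add: cinner_diff_right)
    then show ?thesis
      by (simp add: z_def)
  qed
  have "x = (A ^^ n) ((cadjoint A ^^ n) x)" for n
  proof (induction n)
    case (Suc n)
    have "A (cadjoint A ((cadjoint A ^^ n) x)) = (cadjoint A ^^ n) x"
      using orth by (intro step) (simp flip: cinner_funpow_cadjoint[OF A])
    then show ?case
      using Suc by (simp add: funpow_swap1)
  qed simp
  then have "x \<in> (\<Inter>j\<in>{1..}. range (A ^^ j))"
    by blast
  also have "\<dots> = {0}"
    using pure by (simp only: pure_isometry_def)
  finally show ?thesis
    by simp
qed

text \<open>For isometries this is the joint kernel of \<open>(S - l)\<^sup>*\<close> and \<open>(T - m)\<^sup>*\<close>. The conjugates make the
  functional calculus of \<open>S\<close> and \<open>T\<close> evaluate at \<open>(l, m)\<close> itself.\<close>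

definition joint_eigenspace ::
  "('a::complex_hilbert_space \<Rightarrow> 'a) \<Rightarrow> ('a \<Rightarrow> 'a) \<Rightarrow> complex \<Rightarrow> complex \<Rightarrow> 'a set" where
  "joint_eigenspace S T l m = {h. cadjoint S h = cnj l *\<^sub>C h \<and> cadjoint T h = cnj m *\<^sub>C h}"

lemma joint_eigenspace_swap: "joint_eigenspace S T l m = joint_eigenspace T S m l"
  by (auto simp: joint_eigenspace_def)

lemma subspace_joint_eigenspace:
  assumes "isometry S" "isometry T"
  shows "complex_vector.subspace (joint_eigenspace S T l m)"
proof -
  note S = cadjoint_isometry_clinear[OF assms(1)]
  note T = cadjoint_isometry_clinear[OF assms(2)]
  show ?thesis
    unfolding joint_eigenspace_def
    by (intro complex_vector.subspaceI)
      (auto simp: clinear_zero[OF S] clinear_zero[OF T] clinear_add[OF S] clinear_add[OF T]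
        clinear_scaleC[OF S] clinear_scaleC[OF T] scaleC_add_right scaleC_scaleC mult.commute)
qed

lemma ker_cadjoint_diff_scaleC:
  assumes "isometry A"
  shows "ker (cadjoint (\<lambda>x. A x - l *\<^sub>C x)) = {h. cadjoint A h = cnj l *\<^sub>C h}"
proof -
  note lin = isometry_clinear[OF assms]
  have "ker (cadjoint (\<lambda>x. A x - l *\<^sub>C x)) = {h. \<forall>x. cinner (A x - l *\<^sub>C x) h = 0}"
  proof (rule ker_cadjoint_bounded)
    show "clinear (\<lambda>x. A x - l *\<^sub>C x)"
      by (simp add: Vector_Spaces.linear_iff complex_vector.vector_space_axioms clinear_add[OF lin]
          clinear_scaleC[OF lin] scaleC_add_right complex_vector.scale_right_diff_distrib
          scaleC_scaleC mult.commute)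
    show "norm (A x - l *\<^sub>C x) \<le> (1 + cmod l) * norm x" for x
      using norm_triangle_ineq4[of "A x" "l *\<^sub>C x"]
      by (simp add: norm_scaleC isometry_norm[OF assms] distrib_right)
  qed
  also have "\<dots> = {h. \<forall>x. cinner x (cadjoint A h) = cinner x (cnj l *\<^sub>C h)}"
    by (simp add: cinner_diff_left cinner_scaleC_left cinner_scaleC_right isometry_cadjoint[OF assms])
  also have "\<dots> = {h. cadjoint A h = cnj l *\<^sub>C h}"
    using cinner_right_ext by auto
  finally show ?thesis .
qed

lemma joint_eigenspace_eq_ker:
  assumes "isometry S" "isometry T"
  shows "ker (cadjoint (\<lambda>x. S x - l *\<^sub>C x)) \<inter> ker (cadjoint (\<lambda>x. T x - m *\<^sub>C x))
    = joint_eigenspace S T l m"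
  by (auto simp: ker_cadjoint_diff_scaleC assms joint_eigenspace_def)

lemma joint_eigenspace_finite_dim:
  assumes S: "isometry S" and l: "cmod l < 1" and F: "finite F" "ker (cadjoint S) \<subseteq> complex_vector.span F"
  obtains G where "finite G" "joint_eigenspace S T l m \<subseteq> complex_vector.span G"
proof
  have l': "cmod (cnj l) < 1"
    using l by simp
  interpret pair: vector_space_pair "scaleC :: complex \<Rightarrow> 'a \<Rightarrow> 'a" "scaleC :: complex \<Rightarrow> 'a \<Rightarrow> 'a"
    by unfold_locales
  show "finite (resolvent S (cnj l) ` F)"
    using F by simp
  show "joint_eigenspace S T l m \<subseteq> complex_vector.span (resolvent S (cnj l) ` F)"
  proof
    fix h
    assume "h \<in> joint_eigenspace S T l m"
    then have "h - cnj l *\<^sub>C S h \<in> ker (cadjoint S)"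
      using eigenvector_residual[OF S] by (simp add: joint_eigenspace_def ker_def)
    then have "h - cnj l *\<^sub>C S h \<in> complex_vector.span F"
      using F by blast
    moreover have "h = resolvent S (cnj l) (h - cnj l *\<^sub>C S h)"
      by (rule resolvent_unique[OF S l' refl])
    ultimately show "h \<in> complex_vector.span (resolvent S (cnj l) ` F)"
      using pair.linear_span_image[OF resolvent_clinear[OF S l'], of F] by blast
  qed
qed

section \<open>The polynomial functional calculus\<close>

definition poly_op ::
  "complex poly \<Rightarrow> ('a::complex_hilbert_space \<Rightarrow> 'a) \<Rightarrow> 'a \<Rightarrow> 'a" where
  "poly_op r A x = (\<Sum>i\<le>degree r. coeff r i *\<^sub>C (A ^^ i) x)"

lemma poly_op_bound:
  assumes "degree r \<le> N"
  shows "poly_op r A x = (\<Sum>i\<le>N. coeff r i *\<^sub>C (A ^^ i) x)"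
  unfolding poly_op_def
  by (rule sum.mono_neutral_left) (use assms in \<open>auto simp: coeff_eq_0\<close>)

lemma poly_op_0 [simp]: "poly_op 0 A x = 0"
  by (simp add: poly_op_def)

lemma poly_op_1 [simp]: "poly_op 1 A x = x"
  by (simp add: poly_op_def)

lemma eval_op_poly_op:
  assumes "degree q \<le> N"
  shows "eval_op q S T x = (\<Sum>j\<le>N. poly_op (coeff q j) S ((T ^^ j) x))"
  unfolding eval_op_def poly_op_def[symmetric]
  by (rule sum.mono_neutral_left) (use assms in \<open>auto simp: coeff_eq_0\<close>)

lemma eval_op_0 [simp]: "eval_op 0 S T x = 0"
  by (simp add: eval_op_def)

lemma poly_op_add: "poly_op (r + s) A x = poly_op r A x + poly_op s A x"
  by (simp add: poly_op_bound[of _ "max (degree r) (degree s)"] degree_add_le scaleC_add_left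
      sum.distrib)

lemma eval_op_add: "eval_op (q + r) S T x = eval_op q S T x + eval_op r S T x"
  by (simp add: eval_op_poly_op[of _ "max (degree q) (degree r)"] degree_add_le poly_op_add
      sum.distrib)

lemma eval_op_sum: "eval_op (\<Sum>i\<in>I. f i) S T x = (\<Sum>i\<in>I. eval_op (f i) S T x)"
  by (induction I rule: infinite_finite_induct) (simp_all add: eval_op_add)

lemma poly_op_pCons: "poly_op (pCons a r) A x = a *\<^sub>C x + poly_op r A (A x)"
  by (subst poly_op_bound[OF degree_pCons_le])
    (simp add: sum.atMost_Suc_shift poly_op_def funpow_Suc_right del: funpow.simps(2) sum.atMost_Suc)

lemma eval_op_pCons: "eval_op (pCons a q) S T x = poly_op a S x + eval_op q S T (T x)"
  by (subst eval_op_poly_op[OF degree_pCons_le])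
    (simp add: sum.atMost_Suc_shift eval_op_poly_op[OF order_refl] funpow_Suc_right
      del: funpow.simps(2) sum.atMost_Suc)

lemma poly_op_smult: "poly_op (smult c r) A x = c *\<^sub>C poly_op r A x"
  by (simp add: poly_op_bound[of _ "degree r"] degree_smult_le scaleC_scaleC
      complex_vector.scale_sum_right)

lemma poly_op_clinear:
  assumes "clinear A"
  shows "clinear (poly_op r A)"
  by (induction r)
    (simp_all add: Vector_Spaces.linear_iff poly_op_pCons clinear_add[OF assms]
      clinear_scaleC[OF assms] scaleC_add_right scaleC_scaleC mult.commute
      complex_vector.vector_space_axioms)

lemma poly_op_commute:
  assumes "clinear B" "\<And>x. B (A x) = A (B x)"
  shows "B (poly_op r A x) = poly_op r A (B x)"
  by (induction r arbitrary: x)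
    (simp_all add: clinear_zero[OF assms(1)] poly_op_pCons clinear_add[OF assms(1)]
      clinear_scaleC[OF assms(1)] assms(2))

lemma poly_op_mult:
  assumes "clinear A"
  shows "poly_op (r * s) A x = poly_op r A (poly_op s A x)"
  by (induction r arbitrary: x)
    (simp_all add: poly_op_add poly_op_smult poly_op_pCons poly_op_commute[OF assms])

lemma eval_op_smult:
  assumes "clinear S"
  shows "eval_op (smult a q) S T x = poly_op a S (eval_op q S T x)"
  by (simp add: eval_op_poly_op[of _ "degree q"] degree_smult_le poly_op_mult[OF assms]
      clinear_sum[OF poly_op_clinear[OF assms]])

lemma eval_op_clinear:
  assumes "clinear S" "clinear T"
  shows "clinear (eval_op q S T)"
proof (induction q)
  case (pCons a q)
  show ?case
    unfolding Vector_Spaces.linear_iff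
    by (simp add: eval_op_pCons clinear_add[OF assms(2)] clinear_scaleC[OF assms(2)]
        clinear_add[OF poly_op_clinear[OF assms(1)]] clinear_scaleC[OF poly_op_clinear[OF assms(1)]]
        clinear_add[OF pCons(2)] clinear_scaleC[OF pCons(2)] scaleC_add_right
        complex_vector.vector_space_axioms)
qed (simp add: Vector_Spaces.linear_iff complex_vector.vector_space_axioms)

lemma eval_op_commute:
  assumes "clinear B" "\<And>x. B (S x) = S (B x)" "\<And>x. B (T x) = T (B x)"
  shows "B (eval_op q S T x) = eval_op q S T (B x)"
  by (induction q arbitrary: x)
    (simp_all add: clinear_zero[OF assms(1)] eval_op_pCons clinear_add[OF assms(1)]
      poly_op_commute[of B S, OF assms(1,2)] assms(3))

lemma eval_op_mult:
  assumes "clinear S" "clinear T" "\<And>x. S (T x) = T (S x)"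
  shows "eval_op (q * r) S T x = eval_op q S T (eval_op r S T x)"
  by (induction q arbitrary: x)
    (simp_all add: eval_op_add eval_op_smult[OF assms(1)] eval_op_pCons
      eval_op_commute[of T, OF assms(2)] assms(3))

lemma eval_op_bounded:
  assumes S: "isometry S" and T: "isometry T"
  shows "\<exists>K. \<forall>x. norm (eval_op q S T x) \<le> K * norm x"
proof -
  have norm_funpow: "norm ((A ^^ n) x) = norm x" if "isometry A" for A :: "'a \<Rightarrow> 'a" and n x
    by (induction n) (simp_all add: isometry_norm[OF that])
  have "norm (eval_op q S T x)
      \<le> (\<Sum>j\<le>degree q. \<Sum>i\<le>degree (coeff q j). cmod (coeff (coeff q j) i)) * norm x" for x
  proof -
    have "norm (eval_op q S T x)
        \<le> (\<Sum>j\<le>degree q. \<Sum>i\<le>degree (coeff q j). norm (coeff (coeff q j) i *\<^sub>C (S ^^ i) ((T ^^ j) x)))"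
      unfolding eval_op_def by (intro order_trans[OF norm_sum] sum_mono norm_sum)
    then show ?thesis
      by (simp add: norm_scaleC norm_funpow S T sum_distrib_right)
  qed
  then show ?thesis
    by blast
qed

lemma eval2_0 [simp]: "eval2 0 z w = 0"
  and eval2_add: "eval2 (p + q) z w = eval2 p z w + eval2 q z w"
  and eval2_mult: "eval2 (p * q) z w = eval2 p z w * eval2 q z w"
  and eval2_1: "eval2 1 z w = 1"
  by (simp_all add: eval2_def)

lemma eval2_pCons: "eval2 (pCons a p) z w = poly a z + w * eval2 p z w"
  by (simp add: eval2_def)

lemma eval2_sum: "eval2 (\<Sum>i\<in>I. f i) z w = (\<Sum>i\<in>I. eval2 (f i) z w)"
  by (induction I rule: infinite_finite_induct) (simp_all add: eval2_add)

lemma cinner_poly_op: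
  assumes "isometry S" "cadjoint S h = cnj l *\<^sub>C h"
  shows "cinner (poly_op r S x) h = poly r l * cinner x h"
  by (simp add: poly_op_def cinner_sum_left cinner_scaleC_left poly_altdef sum_distrib_right
      cinner_funpow_eigenvector[OF assms] mult.assoc)

text \<open>On a joint eigenvector of the adjoints the functional calculus is point evaluation.\<close>

lemma cinner_eval_op:
  assumes "isometry S" "isometry T" "h \<in> joint_eigenspace S T l m"
  shows "cinner (eval_op q S T x) h = eval2 q l m * cinner x h"
proof -
  have h: "cadjoint S h = cnj l *\<^sub>C h" "cadjoint T h = cnj m *\<^sub>C h"
    using assms(3) by (simp_all add: joint_eigenspace_def)
  show ?thesis
    by (induction q arbitrary: x)
      (simp_all add: eval_op_pCons eval2_pCons cinner_add_left cinner_poly_op[OF assms(1) h(1)]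
        isometry_cadjoint[OF assms(2)] h(2) cinner_scaleC_right algebra_simps)
qed

section \<open>Determinants of matrices of bivariate polynomials\<close>

lemma eval2_comm_ring_hom: "comm_ring_hom (\<lambda>p. eval2 p z w)"
  by unfold_locales (simp_all add: eval2_add eval2_mult eval2_1)

text \<open>The two properties of a determinant that are needed, for matrices indexed by a finite set:
  the adjugate identity, and that its value at a point detects a kernel of the evaluated matrix.\<close>

lemma polynomial_determinant:
  fixes K :: "'b \<Rightarrow> 'b \<Rightarrow> bipoly"
  assumes fin: "finite D"
  shows "\<exists>\<Delta> adj.
    (\<forall>e\<in>D. \<forall>f\<in>D. (\<Sum>g\<in>D. adj e g * K g f) = (if e = f then \<Delta> else 0)) \<and>
    (\<forall>z w. eval2 \<Delta> z w = 0 \<longleftrightarrow>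
      (\<exists>c. (\<exists>f\<in>D. c f \<noteq> 0) \<and> (\<forall>e\<in>D. (\<Sum>f\<in>D. eval2 (K e f) z w * c f) = 0)))"
proof -
  define n where "n = card D"
  obtain d where d: "bij_betw d {0..<n} D"
    using ex_bij_betw_nat_finite[OF fin] n_def by blast
  define d' where "d' = the_inv_into {0..<n} d"
  have d': "bij_betw d' D {0..<n}"
    unfolding d'_def by (rule bij_betw_the_inv_into[OF d])
  have dd': "d (d' f) = f" if "f \<in> D" for f
    using f_the_inv_into_f_bij_betw[OF d] that by (simp add: d'_def)
  have d'd: "d' (d i) = i" if "i < n" for i
    using the_inv_into_f_f[OF bij_betw_imp_inj_on[OF d]] that by (simp add: d'_def)
  have dD: "d i \<in> D" if "i < n" for i
    using bij_betwE[OF d] that by simp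
  have d'n: "d' f < n" if "f \<in> D" for f
    using bij_betwE[OF d'] that by simp
  have reindex: "(\<Sum>i=0..<n. t (d i)) = (\<Sum>f\<in>D. t f)" for t :: "'b \<Rightarrow> 'c::comm_monoid_add"
    by (rule sum.reindex_bij_betw[OF d])
  define M where "M = Matrix.mat n n (\<lambda>(i, k). K (d i) (d k))"
  have M: "M \<in> carrier_mat n n"
    by (simp add: M_def)
  show ?thesis
  proof (intro exI[of _ "Determinant.det M"] exI[of _ "\<lambda>e g. adj_mat M $$ (d' e, d' g)"]
      conjI ballI allI)
    fix e f
    assume ef: "e \<in> D" "f \<in> D"
    have "(\<Sum>g\<in>D. adj_mat M $$ (d' e, d' g) * K g f) = (\<Sum>i=0..<n. adj_mat M $$ (d' e, i) * M $$ (i, d' f))"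
      unfolding reindex[symmetric]
      by (rule sum.cong) (use ef in \<open>simp_all add: d'd M_def d'n dd'\<close>)
    also have "\<dots> = (adj_mat M * M) $$ (d' e, d' f)"
      using adj_mat(1)[OF M] M ef by (simp add: d'n scalar_prod_def)
    also have "\<dots> = (if e = f then Determinant.det M else 0)"
      unfolding adj_mat(3)[OF M] using ef bij_betw_imp_inj_on[OF d'] by (auto simp: d'n inj_on_eq_iff)
    finally show "(\<Sum>g\<in>D. adj_mat M $$ (d' e, d' g) * K g f) = (if e = f then Determinant.det M else 0)" .
  next
    fix z w
    interpret comm_ring_hom "\<lambda>p. eval2 p z w"
      by (rule eval2_comm_ring_hom)
    define L where "L = map_mat (\<lambda>p. eval2 p z w) M"
    have L: "L \<in> carrier_mat n n"
      by (simp add: L_def M)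
    have prod: "vec_index (L *\<^sub>v v) i = (\<Sum>f\<in>D. eval2 (K (d i) f) z w * vec_index v (d' f))"
      if "v \<in> carrier_vec n" "i < n" for v i
    proof -
      have "vec_index (L *\<^sub>v v) i = (\<Sum>k=0..<n. eval2 (K (d i) (d k)) z w * vec_index v (d' (d k)))"
        using that by (simp add: L_def M_def scalar_prod_def d'd)
      then show ?thesis
        by (simp only: reindex[of "\<lambda>f. eval2 (K (d i) f) z w * vec_index v (d' f)"])
    qed
    have "eval2 (Determinant.det M) z w = Determinant.det L"
      by (simp add: L_def)
    also have "Determinant.det L = 0 \<longleftrightarrow> (\<exists>v. v \<in> carrier_vec n \<and> v \<noteq> 0\<^sub>v n \<and> L *\<^sub>v v = 0\<^sub>v n)"
      by (rule det_0_iff_vec_prod_zero_field[OF L])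
    also have "\<dots> \<longleftrightarrow> (\<exists>c. (\<exists>f\<in>D. c f \<noteq> 0) \<and> (\<forall>e\<in>D. (\<Sum>f\<in>D. eval2 (K e f) z w * c f) = 0))"
      (is "?l \<longleftrightarrow> ?r")
    proof
      assume ?l
      then obtain v where v: "v \<in> carrier_vec n" "v \<noteq> 0\<^sub>v n" "L *\<^sub>v v = 0\<^sub>v n"
        by blast
      then obtain i where "i < n" "vec_index v i \<noteq> 0"
        by (metis carrier_vecD eq_vecI index_zero_vec)
      then have "\<exists>f\<in>D. vec_index v (d' f) \<noteq> 0"
        using dD d'd by metis
      moreover have "(\<Sum>f\<in>D. eval2 (K e f) z w * vec_index v (d' f)) = 0" if "e \<in> D" for e
        using prod[OF v(1) d'n[OF that]] v(3) by (simp add: dd' that d'n)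
      ultimately show ?r
        by (intro exI[of _ "\<lambda>f. vec_index v (d' f)"]) blast
    next
      assume ?r
      then obtain c f where c: "f \<in> D" "c f \<noteq> 0"
        "\<And>e. e \<in> D \<Longrightarrow> (\<Sum>f\<in>D. eval2 (K e f) z w * c f) = 0"
        by blast
      let ?v = "Matrix.vec n (\<lambda>i. c (d i))"
      have "vec_index ?v (d' f) \<noteq> 0"
        using c by (simp add: d'n dd')
      then have "?v \<noteq> 0\<^sub>v n"
        using d'n[OF c(1)] by (metis index_zero_vec(1))
      moreover have "L *\<^sub>v ?v = 0\<^sub>v n"
      proof (rule eq_vecI)
        fix i
        assume i: "i < dim_vec (0\<^sub>v n)"
        then have "vec_index (L *\<^sub>v ?v) i = (\<Sum>f\<in>D. eval2 (K (d i) f) z w * vec_index ?v (d' f))"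
          by (intro prod) simp_all
        also have "\<dots> = (\<Sum>f\<in>D. eval2 (K (d i) f) z w * c f)"
          by (rule sum.cong) (simp_all add: d'n dd')
        finally show "vec_index (L *\<^sub>v ?v) i = vec_index (0\<^sub>v n) i"
          using c(3) dD i by simp
      qed (use L in simp)
      ultimately show ?l
        by (intro exI[of _ ?v]) simp
    qed
    finally show "eval2 (Determinant.det M) z w = 0 \<longleftrightarrow>
      (\<exists>c. (\<exists>f\<in>D. c f \<noteq> 0) \<and> (\<forall>e\<in>D. (\<Sum>f\<in>D. eval2 (K e f) z w * c f) = 0))" .
  qed
qed

text \<open>If \<open>a\<^sup>* a c = 0\<close>, then \<open>\<parallel>a c\<parallel>\<^sup>2 = c\<^sup>* a\<^sup>* a c = 0\<close>.\<close>

lemma gram_kernel: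
  fixes a :: "'r \<Rightarrow> 'b \<Rightarrow> complex"
  assumes "finite R"
    and zero: "\<And>e. e \<in> D \<Longrightarrow> (\<Sum>f\<in>D. (\<Sum>r\<in>R. cnj (a r e) * a r f) * c f) = 0"
    and r: "r \<in> R"
  shows "(\<Sum>f\<in>D. a r f * c f) = 0"
proof -
  define u where "u r = (\<Sum>f\<in>D. a r f * c f)" for r
  have "(\<Sum>r\<in>R. cnj (u r) * u r) = (\<Sum>r\<in>R. \<Sum>e\<in>D. \<Sum>f\<in>D. cnj (c e) * (cnj (a r e) * a r f * c f))"
    unfolding u_def cnj_sum sum_product by (simp add: mult_ac)
  also have "\<dots> = (\<Sum>e\<in>D. \<Sum>r\<in>R. \<Sum>f\<in>D. cnj (c e) * (cnj (a r e) * a r f * c f))"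
    by (rule sum.swap)
  also have "\<dots> = (\<Sum>e\<in>D. \<Sum>f\<in>D. \<Sum>r\<in>R. cnj (c e) * (cnj (a r e) * a r f * c f))"
    by (intro sum.cong refl sum.swap)
  also have "\<dots> = (\<Sum>e\<in>D. cnj (c e) * (\<Sum>f\<in>D. (\<Sum>r\<in>R. cnj (a r e) * a r f) * c f))"
    by (simp add: sum_distrib_left sum_distrib_right)
  also have "\<dots> = 0"
    by (rule sum.neutral) (simp add: zero)
  finally have "complex_of_real (\<Sum>r\<in>R. (cmod (u r))\<^sup>2) = 0"
    by (simp only: of_real_sum complex_norm_square) (simp only: mult.commute)
  then have "(\<Sum>r\<in>R. (cmod (u r))\<^sup>2) = 0"
    by (simp only: of_real_eq_0_iff)
  then show ?thesis
    using assms(1) r by (simp add: sum_nonneg_eq_0_iff u_def)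
qed

section \<open>Pairs of commuting pure isometries\<close>

locale finite_isopair =
  fixes S T :: "'a::complex_hilbert_space \<Rightarrow> 'a"
  assumes pure: "pure_isometry S" "pure_isometry T"
    and commute: "S (T x) = T (S x)"
    and finite_S: "\<exists>F. finite F \<and> ker (cadjoint S) \<subseteq> complex_vector.span F"
    and finite_T: "\<exists>F. finite F \<and> ker (cadjoint T) \<subseteq> complex_vector.span F"
begin

lemma isometries: "isometry S" "isometry T"
  using pure by (simp_all add: pure_isometry_def)

lemmas lin = isometries[THEN isometry_clinear]
lemmas adjoint_lin = isometries[THEN cadjoint_isometry_clinear]
lemmas adjoint = isometries[THEN isometry_cadjoint]

lemma swap: "finite_isopair T S"
  by unfold_locales (simp_all add: pure commute finite_S finite_T)

lemma adjoint_commute: "cadjoint S (cadjoint T x) = cadjoint T (cadjoint S x)"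
  by (rule cinner_right_ext) (simp add: commute flip: adjoint)

definition wandering :: "'a set" where
  "wandering = ker (cadjoint (S \<circ> T))"

lemma wandering_swap: "finite_isopair.wandering T S = wandering"
  by (simp add: wandering_def finite_isopair.wandering_def[OF swap] commute comp_def)

lemma isometry_product: "isometry (S \<circ> T)"
  by (rule isometry_compose[OF isometries])

lemma adjoint_product: "cadjoint (S \<circ> T) x = cadjoint T (cadjoint S x)"
  by (rule cadjoint_compose[OF isometries])

lemma pure_product: "pure_isometry (S \<circ> T)"
proof -
  have T_pow: "(S ^^ n) (T x) = T ((S ^^ n) x)" for n x
    by (induction n) (simp_all add: commute)
  have "((S \<circ> T) ^^ n) x = (S ^^ n) ((T ^^ n) x)" for n x
    by (induction n arbitrary: x) (simp_all add: T_pow)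
  then have "range ((S \<circ> T) ^^ n) \<subseteq> range (S ^^ n)" for n
    by auto
  then have "(\<Inter>j\<in>{1..}. range ((S \<circ> T) ^^ j)) \<subseteq> (\<Inter>j\<in>{1..}. range (S ^^ j))"
    by blast
  moreover have "0 \<in> range ((S \<circ> T) ^^ j)" for j
    using clinear_zero[OF funpow_clinear[OF isometry_clinear[OF isometry_product]]]
    by (metis rangeI)
  ultimately show ?thesis
    using pure(1) isometry_product unfolding pure_isometry_def by blast
qed

lemma subspace_wandering: "complex_vector.subspace wandering"
  unfolding wandering_def ker_def
  by (intro complex_vector.subspaceI)
    (simp_all add: adjoint_product clinear_zero[OF adjoint_lin(1)] clinear_zero[OF adjoint_lin(2)]
      clinear_add[OF adjoint_lin(1)] clinear_add[OF adjoint_lin(2)]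
      clinear_scaleC[OF adjoint_lin(1)] clinear_scaleC[OF adjoint_lin(2)])

text \<open>Split \<open>y \<in> ker (S T)\<^sup>*\<close> into \<open>y - S S\<^sup>* y \<in> ker S\<^sup>*\<close> and \<open>S (S\<^sup>* y)\<close> with \<open>S\<^sup>* y \<in> ker T\<^sup>*\<close>.\<close>

lemma wandering_finite_dim: "\<exists>F. finite F \<and> wandering \<subseteq> complex_vector.span F"
proof -
  obtain F G where F: "finite F" "ker (cadjoint S) \<subseteq> complex_vector.span F"
    and G: "finite G" "ker (cadjoint T) \<subseteq> complex_vector.span G"
    using finite_S finite_T by blast
  interpret pair: vector_space_pair "scaleC :: complex \<Rightarrow> 'a \<Rightarrow> 'a" "scaleC :: complex \<Rightarrow> 'a \<Rightarrow> 'a"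
    by unfold_locales
  have "y \<in> complex_vector.span (F \<union> S ` G)" if y: "y \<in> wandering" for y
  proof -
    have "y - S (cadjoint S y) \<in> ker (cadjoint S)"
      by (simp add: ker_def clinear_diff[OF adjoint_lin(1)]
          cadjoint_isometry_cancel[OF isometries(1)])
    then have 1: "y - S (cadjoint S y) \<in> complex_vector.span (F \<union> S ` G)"
      using F(2) complex_vector.span_mono[of F "F \<union> S ` G"] by blast
    have "cadjoint S y \<in> ker (cadjoint T)"
      using y by (simp add: wandering_def ker_def adjoint_product)
    then have "S (cadjoint S y) \<in> S ` complex_vector.span G"
      using G(2) by blast
    also have "\<dots> = complex_vector.span (S ` G)"
      by (rule pair.linear_span_image[OF lin(1), symmetric])
    also have "\<dots> \<subseteq> complex_vector.span (F \<union> S ` G)"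
      by (rule complex_vector.span_mono) blast
    finally show ?thesis
      using complex_vector.span_add[OF 1] by fastforce
  qed
  then show ?thesis
    using F(1) G(1) by (intro exI[of _ "F \<union> S ` G"]) blast
qed

lemma joint_eigenspace_finite:
  assumes "cmod l < 1"
  obtains G where "finite G" "joint_eigenspace S T l m \<subseteq> complex_vector.span G"
  using finite_S joint_eigenspace_finite_dim[OF isometries(1) assms] by metis

lemma joint_eigenspace_subspace: "complex_vector.subspace (joint_eigenspace S T l m)"
  by (rule subspace_joint_eigenspace[OF isometries])

text \<open>The identity of Berger, Coburn and Lebow: \<open>S\<close> maps the wandering subspace \<open>W = ker (S T)\<^sup>*\<close>
  into \<open>W + S T W\<close>, because \<open>(S T)\<^sup>* S = T\<^sup>*\<close> leaves \<open>W\<close> invariant. So in the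
  Wold decomposition of \<open>S T\<close> both isometries act as matrices that are linear in the shift.\<close>

lemma wandering_relation:
  assumes D: "orthonormal D" "complex_vector.span D = wandering" and e: "e \<in> wandering"
  shows "S e = (\<Sum>f\<in>D. cinner (S e) f *\<^sub>C f + cinner e (T f) *\<^sub>C S (T f))"
proof -
  note cancel = cadjoint_isometry_cancel[OF isometries(1)] cadjoint_isometry_cancel[OF isometries(2)]
  have e0: "cadjoint T (cadjoint S e) = 0"
    using e by (simp add: wandering_def ker_def adjoint_product)
  have Te: "cadjoint T e \<in> wandering"
    using e0 by (simp add: wandering_def ker_def adjoint_product adjoint_commute
        clinear_zero[OF adjoint_lin(2)])
  \<comment> \<open>the component of \<open>S e\<close> in \<open>W\<close>; the other one is \<open>S T (S T)\<^sup>* S e\<close>\<close>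
  define r where "r = S e - S (T (cadjoint T e))"
  have "r \<in> wandering"
    by (simp add: r_def wandering_def ker_def adjoint_product clinear_diff[OF adjoint_lin(1)]
        clinear_diff[OF adjoint_lin(2)] cancel)
  then have "r = (\<Sum>f\<in>D. cinner r f *\<^sub>C f)"
    using D by (intro orthonormal_expansion) auto
  also have "\<dots> = (\<Sum>f\<in>D. cinner (S e) f *\<^sub>C f)"
  proof (rule sum.cong[OF refl])
    fix f
    assume "f \<in> D"
    then have "f \<in> wandering"
      using D(2) complex_vector.span_base by auto
    then have "cadjoint T (cadjoint S f) = 0"
      by (simp add: wandering_def ker_def adjoint_product)
    then show "cinner r f *\<^sub>C f = cinner (S e) f *\<^sub>C f"
      by (simp add: r_def cinner_diff_left adjoint)
  qed
  finally have 1: "S e - S (T (cadjoint T e)) = (\<Sum>f\<in>D. cinner (S e) f *\<^sub>C f)"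
    by (simp only: r_def)
  have "cadjoint T e = (\<Sum>f\<in>D. cinner (cadjoint T e) f *\<^sub>C f)"
    using D Te by (intro orthonormal_expansion) auto
  also have "\<dots> = (\<Sum>f\<in>D. cinner e (T f) *\<^sub>C f)"
    by (simp add: isometry_cadjoint'[OF isometries(2)])
  finally have "S (T (cadjoint T e)) = S (T (\<Sum>f\<in>D. cinner e (T f) *\<^sub>C f))"
    by (rule arg_cong)
  then have 2: "S (T (cadjoint T e)) = (\<Sum>f\<in>D. cinner e (T f) *\<^sub>C S (T f))"
    by (simp add: clinear_sum[OF lin(1)] clinear_sum[OF lin(2)] clinear_scaleC[OF lin(1)]
        clinear_scaleC[OF lin(2)])
  show ?thesis
    using 1 2 by (simp add: sum.distrib diff_eq_eq)
qed

lemma wandering_cyclic: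
  assumes D: "complex_vector.span D = wandering"
    and orth: "\<And>n d. d \<in> D \<Longrightarrow> cinner (((S \<circ> T) ^^ n) d) x = 0"
  shows "x = 0"
proof (rule pure_isometry_cyclic[OF pure_product])
  note lin_pow = funpow_clinear[OF isometry_clinear[OF isometry_product]]
  fix n d
  assume "cadjoint (S \<circ> T) d = 0"
  then have "d \<in> complex_vector.span D"
    by (simp add: D wandering_def ker_def)
  then show "cinner (((S \<circ> T) ^^ n) d) x = 0"
  proof (induction rule: complex_vector.span_induct_alt)
    case base
    show ?case
      unfolding clinear_zero[OF lin_pow] by (rule cinner_zero_left)
  next
    case (step c x' y)
    show ?case
      unfolding clinear_add[OF lin_pow] clinear_scaleC[OF lin_pow] cinner_add_left cinner_scaleC_left
        orth[OF step(1)] step(2)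
      by simp
  qed
qed

end

section \<open>A polynomial that detects jumps of the eigenspace dimension\<close>

text \<open>An entry of the matrix of \<open>X - A\<close>, where \<open>A\<close> is one isometry of the pair, \<open>B\<close> the other one, and
  \<open>X\<close> the coordinate polynomial that takes the value \<open>A\<close> in the functional calculus. By the identity
  of Berger, Coburn and Lebow the matrix of \<open>A\<close> in a basis of the wandering subspace is linear
  in the shift \<open>S T\<close>, which is replaced by \<open>z w\<close>.\<close>

definition pencil ::
  "bipoly \<Rightarrow> ('a::complex_hilbert_space \<Rightarrow> 'a) \<Rightarrow> ('a \<Rightarrow> 'a) \<Rightarrow> 'a \<Rightarrow> 'a \<Rightarrow> bipoly" where
  "pencil X A B e f =
     (if e = f then X else 0) - [:[:cinner (A e) f:]:] - [:0, [:0, cinner e (B f):]:]"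

lemma eval2_pencil:
  "eval2 (pencil X A B e f) z w =
     (if e = f then eval2 X z w else 0) - cinner (A e) f - cinner e (B f) * (z * w)"
  by (simp add: pencil_def eval2_def)

lemma eval2_coordinates [simp]:
  "eval2 [:[:0, 1:]:] z w = z" "eval2 [:0, 1:] z w = w" "eval2 [:[:c:]:] z w = c"
  by (simp_all add: eval2_def)

lemma eval_op_const [simp]: "eval_op [:[:c:]:] S T x = c *\<^sub>C x"
  by (simp add: eval_op_pCons poly_op_pCons)

lemma eval_op_pencil:
  assumes "clinear S" "clinear T"
  shows "eval_op (pencil X A B e f) S T x =
    (if e = f then eval_op X S T x else 0) - cinner (A e) f *\<^sub>C x - cinner e (B f) *\<^sub>C S (T x)"
proof -
  have pencil: "pencil X A B e f =
      (if e = f then X else 0) + ([:[:- cinner (A e) f:]:] + [:0, [:0, - cinner e (B f):]:])"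
    by (simp add: pencil_def)
  show ?thesis
    unfolding pencil eval_op_add
    by (simp add: eval_op_pCons poly_op_pCons scaleC_minus_left clinear_zero[OF assms(1)]
        clinear_scaleC[OF assms(1)])
qed

context finite_isopair
begin

lemma pencil_relation:
  assumes D: "orthonormal D" "complex_vector.span D = wandering" and e: "e \<in> D"
  shows "(\<Sum>f\<in>D. eval_op (pencil [:[:0, 1:]:] S T e f) S T f) = 0"
    and "(\<Sum>f\<in>D. eval_op (pencil [:0, 1:] T S e f) S T f) = 0"
proof -
  interpret swap: finite_isopair T S
    by (rule swap)
  have eW: "e \<in> wandering"
    using e D(2) complex_vector.span_base by auto
  have fin: "finite D"
    using D(1) by (simp add: orthonormal_def)
  have "(\<Sum>f\<in>D. eval_op (pencil [:[:0, 1:]:] S T e f) S T f)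
      = (\<Sum>f\<in>D. if e = f then S f else 0) - (\<Sum>f\<in>D. cinner (S e) f *\<^sub>C f + cinner e (T f) *\<^sub>C S (T f))"
    unfolding sum_subtractf[symmetric] eval_op_pencil[OF lin]
    by (rule sum.cong) (simp_all add: eval_op_pCons poly_op_pCons)
  also have "(\<Sum>f\<in>D. if e = f then S f else 0) = S e"
    using fin e by simp
  finally show "(\<Sum>f\<in>D. eval_op (pencil [:[:0, 1:]:] S T e f) S T f) = 0"
    using wandering_relation[OF D eW] by simp
  have "(\<Sum>f\<in>D. eval_op (pencil [:0, 1:] T S e f) S T f)
      = (\<Sum>f\<in>D. if e = f then T f else 0) - (\<Sum>f\<in>D. cinner (T e) f *\<^sub>C f + cinner e (S f) *\<^sub>C T (S f))"
    unfolding sum_subtractf[symmetric] eval_op_pencil[OF lin]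
    by (rule sum.cong) (simp_all add: eval_op_pCons poly_op_pCons commute)
  also have "(\<Sum>f\<in>D. if e = f then T f else 0) = T e"
    using fin e by simp
  finally show "(\<Sum>f\<in>D. eval_op (pencil [:0, 1:] T S e f) S T f) = 0"
    using swap.wandering_relation[of D e] D eW wandering_swap by simp
qed

text \<open>The converse of evaluating the relations on a joint eigenvector: a vector in the kernel of
  the evaluated pencils is the coordinate vector of the joint eigenvector obtained from it by the
  resolvent of \<open>S T\<close>.\<close>

lemma joint_eigenvector_of_pencil_kernel:
  assumes D: "orthonormal D" "complex_vector.span D = wandering"
    and lm: "cmod l < 1" "cmod m < 1"
    and S0: "\<And>e. e \<in> D \<Longrightarrow> (\<Sum>f\<in>D. eval2 (pencil [:[:0, 1:]:] S T e f) l m * c f) = 0"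
    and T0: "\<And>e. e \<in> D \<Longrightarrow> (\<Sum>f\<in>D. eval2 (pencil [:0, 1:] T S e f) l m * c f) = 0"
  shows "\<exists>h\<in>joint_eigenspace S T l m. \<forall>f\<in>D. cinner f h = c f"
proof -
  interpret swap: finite_isopair T S
    by (rule swap)
  have fin: "finite D"
    using D(1) by (simp add: orthonormal_def)
  have DW: "f \<in> wandering" if "f \<in> D" for f
    using that D(2) complex_vector.span_base by auto
  note V = isometry_product
  have lm': "cmod (cnj (l * m)) < 1"
    using mult_strict_mono'[of "cmod l" 1 "cmod m" 1] lm by (simp add: norm_mult)
  define x where "x = (\<Sum>f\<in>D. cnj (c f) *\<^sub>C f)"
  define h where "h = resolvent (S \<circ> T) (cnj (l * m)) x"
  have "x \<in> wandering"
    unfolding x_def D(2)[symmetric]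
    by (intro complex_vector.span_sum complex_vector.span_scale complex_vector.span_base)
  then have Vh: "cadjoint (S \<circ> T) h = cnj (l * m) *\<^sub>C h"
    unfolding h_def by (intro resolvent_eigenvector[OF V lm']) (simp add: wandering_def ker_def)
  have coord: "cinner f h = c f" if f: "f \<in> D" for f
  proof -
    have hx: "h = x + cnj (l * m) *\<^sub>C (S \<circ> T) h"
      using resolvent_eq[OF V lm', of x] by (simp only: h_def diff_eq_eq add.commute)
    have "cinner h f = cinner (x + cnj (l * m) *\<^sub>C (S \<circ> T) h) f"
      by (rule arg_cong[OF hx])
    also have "\<dots> = cinner x f"
      using DW[OF f] unfolding cinner_add_left cinner_scaleC_left isometry_cadjoint[OF V]
      by (simp add: wandering_def ker_def)
    also have "\<dots> = cnj (c f)"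
      unfolding x_def by (rule orthonormal_coefficient[OF D(1) f])
    finally show ?thesis
      using cinner_commute[of f h] by simp
  qed
  have pair: "cinner (\<Sum>f\<in>D. a f *\<^sub>C f + b f *\<^sub>C S (T f)) h = (\<Sum>f\<in>D. (a f + b f * (l * m)) * c f)" for a b
  proof -
    have "cinner (S (T f)) h = l * m * c f" if "f \<in> D" for f
      using isometry_cadjoint[OF V, of f h] coord[OF that] by (simp add: Vh cinner_scaleC_right)
    then show ?thesis
      unfolding cinner_sum_left
      by (intro sum.cong) (simp_all add: cinner_add_left cinner_scaleC_left coord algebra_simps)
  qed
  have Se: "cinner (S e) h = l * c e" if e: "e \<in> D" for e
  proof -
    have "0 = (\<Sum>f\<in>D. eval2 (pencil [:[:0, 1:]:] S T e f) l m * c f)"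
      by (rule S0[OF e, symmetric])
    also have "\<dots> = (\<Sum>f\<in>D. (if e = f then l * c f else 0) - (cinner (S e) f + cinner e (T f) * (l * m)) * c f)"
      unfolding eval2_pencil by (rule sum.cong) (simp_all add: algebra_simps)
    also have "\<dots> = l * c e - cinner (S e) h"
      unfolding sum_subtractf pair[symmetric] wandering_relation[OF D DW[OF e], symmetric]
      using fin e by simp
    finally show ?thesis
      by simp
  qed
  have Te: "cinner (T e) h = m * c e" if e: "e \<in> D" for e
  proof -
    have rel: "T e = (\<Sum>f\<in>D. cinner (T e) f *\<^sub>C f + cinner e (S f) *\<^sub>C S (T f))"
      using swap.wandering_relation[of D e] D DW[OF e] by (simp add: wandering_swap commute)
    have "0 = (\<Sum>f\<in>D. eval2 (pencil [:0, 1:] T S e f) l m * c f)"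
      by (rule T0[OF e, symmetric])
    also have "\<dots> = (\<Sum>f\<in>D. (if e = f then m * c f else 0) - (cinner (T e) f + cinner e (S f) * (l * m)) * c f)"
      unfolding eval2_pencil by (rule sum.cong) (simp_all add: algebra_simps)
    also have "\<dots> = m * c e - cinner (T e) h"
      unfolding sum_subtractf pair[symmetric] rel[symmetric]
      using fin e by simp
    finally show ?thesis
      by simp
  qed
  have eigen: "cadjoint A h = cnj k *\<^sub>C h"
    if A: "isometry A" "\<And>x. A ((S \<circ> T) x) = (S \<circ> T) (A x)"
      and Ae: "\<And>e. e \<in> D \<Longrightarrow> cinner (A e) h = k * c e" for A k
  proof -
    have A_pow: "A (((S \<circ> T) ^^ n) x) = ((S \<circ> T) ^^ n) (A x)" for n x
      by (induction n) (simp_all only: funpow.simps comp_apply[of _ "(S \<circ> T) ^^ _"] id_apply A(2))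
    note pow = cinner_funpow_eigenvector[OF V Vh]
    have "cadjoint A h - cnj k *\<^sub>C h = 0"
    proof (rule wandering_cyclic[OF D(2)])
      fix n d
      assume d: "d \<in> D"
      have "cinner (((S \<circ> T) ^^ n) d) (cadjoint A h) = (l * m) ^ n * cinner (A d) h"
        unfolding isometry_cadjoint[OF A(1), symmetric] A_pow pow ..
      moreover have "cinner (((S \<circ> T) ^^ n) d) (cnj k *\<^sub>C h) = k * ((l * m) ^ n * cinner d h)"
        unfolding cinner_scaleC_right pow by simp
      ultimately show "cinner (((S \<circ> T) ^^ n) d) (cadjoint A h - cnj k *\<^sub>C h) = 0"
        unfolding cinner_diff_right by (simp add: Ae[OF d] coord[OF d])
    qed
    then show ?thesis
      by simp
  qed
  have "h \<in> joint_eigenspace S T l m"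
    unfolding joint_eigenspace_def
    using eigen[OF isometries(1) _ Se] eigen[OF isometries(2) _ Te] by (simp add: commute)
  then show ?thesis
    using coord by blast
qed

text \<open>Evaluating the pencils at a point \<open>(l, m)\<close> of the bidisk gives a matrix whose kernel consists of
  the coordinate vectors of the joint eigenspace \<open>E\<close> of that point. Adjoin the conjugate coordinates
  of an orthonormal basis of \<open>E\<close> as constant rows. The resulting matrix of polynomials has full column
  rank at \<open>(l, m)\<close>, so multiplying it from the left by the conjugate transpose of its value
  at \<open>(l, m)\<close> gives a square matrix that is invertible there. At a point where
  the eigenspace has larger dimension than \<open>E\<close>, some eigenvector is annihilated by the added rows,
  and the determinant vanishes. If \<open>E = 0\<close>, then no rows are added and Cramer's rule shows that
  the determinant annihilates the wandering subspace.\<close>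

lemma dimension_jump_polynomial:
  assumes lm: "cmod l < 1" "cmod m < 1"
  obtains \<Delta> where "eval2 \<Delta> l m \<noteq> 0"
    "\<And>z w. cmod z < 1 \<Longrightarrow>
      complex_vector.dim (joint_eigenspace S T l m) < complex_vector.dim (joint_eigenspace S T z w) \<Longrightarrow>
      eval2 \<Delta> z w = 0"
    "complex_vector.dim (joint_eigenspace S T l m) = 0 \<Longrightarrow> eval_op \<Delta> S T = (\<lambda>x. 0)"
proof -
  obtain F where F: "finite F" "wandering \<subseteq> complex_vector.span F"
    using wandering_finite_dim by blast
  obtain D where D: "orthonormal D" "complex_vector.span D = wandering"
    by (rule orthonormal_basis_exists[OF subspace_wandering F])
  obtain G where G: "finite G" "joint_eigenspace S T l m \<subseteq> complex_vector.span G"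
    by (rule joint_eigenspace_finite[OF lm(1)])
  obtain B where B: "orthonormal B" "complex_vector.span B = joint_eigenspace S T l m"
    "card B = complex_vector.dim (joint_eigenspace S T l m)"
    by (rule orthonormal_basis_exists[OF joint_eigenspace_subspace G])
  have fin: "finite D" "finite B"
    using D(1) B(1) by (simp_all add: orthonormal_def)
  define K :: "'a + 'a + 'a \<Rightarrow> 'a \<Rightarrow> bipoly" where
    "K = case_sum (pencil [:[:0, 1:]:] S T) (case_sum (pencil [:0, 1:] T S) (\<lambda>b f. [:[:cinner b f:]:]))"
  define R where "R = D <+> (D <+> B)"
  have finR: "finite R"
    using fin by (simp add: R_def)
  \<comment> \<open>the matrix \<open>K(l, m)\<^sup>* K(z, w)\<close>\<close>
  define N where "N e f = (\<Sum>r\<in>R. [:[:cnj (eval2 (K r e) l m):]:] * K r f)" for e f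
  obtain \<Delta> adj where det:
    "(\<forall>e\<in>D. \<forall>f\<in>D. (\<Sum>g\<in>D. adj e g * N g f) = (if e = f then \<Delta> else 0)) \<and>
     (\<forall>z w. eval2 \<Delta> z w = 0 \<longleftrightarrow>
      (\<exists>c. (\<exists>f\<in>D. c f \<noteq> 0) \<and> (\<forall>e\<in>D. (\<Sum>f\<in>D. eval2 (N e f) z w * c f) = 0)))"
    using polynomial_determinant[OF fin(1), of N] by (elim exE) (erule that)
  have adj: "(\<Sum>g\<in>D. adj e g * N g f) = (if e = f then \<Delta> else 0)" if "e \<in> D" "f \<in> D" for e f
    by (rule bspec[OF bspec[OF conjunct1[OF det] that(1)] that(2)])
  note \<Delta> = spec[OF spec[OF conjunct2[OF det]]]
  have evalN: "eval2 (N e f) z w = (\<Sum>r\<in>R. cnj (eval2 (K r e) l m) * eval2 (K r f) z w)" for e f z w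
    by (simp only: N_def eval2_sum eval2_mult eval2_coordinates)
  have cyclic: "h = 0"
    if h: "h \<in> joint_eigenspace S T z w" and zero: "\<And>f. f \<in> D \<Longrightarrow> cinner f h = 0" for h z w
  proof (rule wandering_cyclic[OF D(2)])
    fix n d
    assume d: "d \<in> D"
    have "cadjoint (S \<circ> T) h = cnj (z * w) *\<^sub>C h"
      using h by (simp add: adjoint_product joint_eigenspace_def clinear_scaleC[OF adjoint_lin(2)]
          scaleC_scaleC)
    then show "cinner (((S \<circ> T) ^^ n) d) h = 0"
      using cinner_funpow_eigenvector[OF isometry_product] zero[OF d] by (metis mult_zero_right)
  qed
  show thesis
  proof (rule that)
    show "eval2 \<Delta> l m \<noteq> 0"
    proof
      assume "eval2 \<Delta> l m = 0"
      then obtain c g where c: "g \<in> D" "c g \<noteq> 0"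
        and zero: "\<And>e. e \<in> D \<Longrightarrow> (\<Sum>f\<in>D. eval2 (N e f) l m * c f) = 0"
        unfolding \<Delta> by blast
      have row: "(\<Sum>f\<in>D. eval2 (K r f) l m * c f) = 0" if "r \<in> R" for r
        by (rule gram_kernel[OF finR _ that, of D]) (use zero in \<open>simp add: evalN\<close>)
      have "(\<Sum>f\<in>D. eval2 (pencil [:[:0, 1:]:] S T e f) l m * c f) = 0"
        and "(\<Sum>f\<in>D. eval2 (pencil [:0, 1:] T S e f) l m * c f) = 0" if "e \<in> D" for e
        using row[of "Inl e"] row[of "Inr (Inl e)"] that by (auto simp: R_def K_def)
      then have "\<exists>h\<in>joint_eigenspace S T l m. \<forall>f\<in>D. cinner f h = c f"
        by (rule joint_eigenvector_of_pencil_kernel[OF D lm])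
      then obtain h where h: "h \<in> joint_eigenspace S T l m" "\<And>f. f \<in> D \<Longrightarrow> cinner f h = c f"
        by blast
      have cb: "(\<Sum>f\<in>D. cinner b f * c f) = 0" if "b \<in> B" for b
        using row[of "Inr (Inr b)"] that by (simp add: R_def K_def InrI)
      have hB: "h = (\<Sum>b\<in>B. cinner h b *\<^sub>C b)"
        using B h(1) by (intro orthonormal_expansion) simp_all
      have "(\<Sum>f\<in>D. cnj (c f) * c f) = (\<Sum>f\<in>D. \<Sum>b\<in>B. cinner h b * (cinner b f * c f))"
      proof (rule sum.cong[OF refl])
        fix f
        assume f: "f \<in> D"
        have "cnj (c f) = cinner h f"
          using h(2)[OF f] cinner_commute[of h f] by simp
        also have "\<dots> = (\<Sum>b\<in>B. cinner h b * cinner b f)"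
          by (subst hB) (simp add: cinner_sum_left cinner_scaleC_left)
        finally show "cnj (c f) * c f = (\<Sum>b\<in>B. cinner h b * (cinner b f * c f))"
          by (simp add: sum_distrib_right mult.assoc)
      qed
      also have "\<dots> = (\<Sum>b\<in>B. cinner h b * (\<Sum>f\<in>D. cinner b f * c f))"
        by (subst sum.swap) (simp add: sum_distrib_left)
      also have "\<dots> = 0"
        by (simp add: cb)
      finally have "complex_of_real (\<Sum>f\<in>D. (cmod (c f))\<^sup>2) = 0"
        by (simp only: of_real_sum complex_norm_square) (simp only: mult.commute)
      then have "(\<Sum>f\<in>D. (cmod (c f))\<^sup>2) = 0"
        by (simp only: of_real_eq_0_iff)
      then show False
        using c fin by (simp add: sum_nonneg_eq_0_iff)
    qed
  next
    fix z w
    assume z: "cmod z < 1" and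
      dim: "complex_vector.dim (joint_eigenspace S T l m) < complex_vector.dim (joint_eigenspace S T z w)"
    define g where "g b = (\<Sum>f\<in>D. cinner b f *\<^sub>C f)" for b
    obtain G' where G': "finite G'" "joint_eigenspace S T z w \<subseteq> complex_vector.span G'"
      by (rule joint_eigenspace_finite[OF z])
    have "card (g ` B) < complex_vector.dim (joint_eigenspace S T z w)"
      using card_image_le[OF fin(2), of g] dim B(3) by simp
    then obtain h where h: "h \<in> joint_eigenspace S T z w" "h \<noteq> 0" "\<And>b. b \<in> B \<Longrightarrow> cinner h (g b) = 0"
      using exists_orthogonal_vector[OF joint_eigenspace_subspace G'] fin(2)
      by (metis finite_imageI imageI)
    have row: "(\<Sum>f\<in>D. eval2 (K r f) z w * cinner f h) = 0" if r: "r \<in> R" for r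
    proof -
      have "(\<Sum>f\<in>D. eval2 (X f) z w * cinner f h) = 0"
        if "(\<Sum>f\<in>D. eval_op (X f) S T f) = 0" for X
        using arg_cong[OF that, of "\<lambda>x. cinner x h"]
        by (simp add: cinner_sum_left cinner_eval_op[OF isometries h(1)])
      note relation = this
      consider e where "r = Inl e" "e \<in> D" | e where "r = Inr (Inl e)" "e \<in> D"
        | b where "r = Inr (Inr b)" "b \<in> B"
        using r by (auto simp: R_def)
      then show ?thesis
      proof cases
        case (3 b)
        have "(\<Sum>f\<in>D. cinner b f * cinner f h) = cinner (g b) h"
          by (simp add: g_def cinner_sum_left cinner_scaleC_left)
        also have "\<dots> = 0"
          using h(3)[OF 3(2)] cinner_commute[of "g b" h] by simp
        finally show ?thesis
          by (simp add: K_def 3(1))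
      qed (simp_all add: K_def relation pencil_relation[OF D])
    qed
    have "(\<Sum>f\<in>D. eval2 (N e f) z w * cinner f h) = 0" for e
    proof -
      have "(\<Sum>f\<in>D. eval2 (N e f) z w * cinner f h)
          = (\<Sum>r\<in>R. cnj (eval2 (K r e) l m) * (\<Sum>f\<in>D. eval2 (K r f) z w * cinner f h))"
        by (simp add: evalN sum_distrib_left sum_distrib_right mult.assoc sum.swap[of _ D R])
      then show ?thesis
        by (simp add: row)
    qed
    moreover have "\<exists>f\<in>D. cinner f h \<noteq> 0"
      using cyclic[OF h(1)] h(2) by blast
    ultimately show "eval2 \<Delta> z w = 0"
      unfolding \<Delta> by (intro exI[of _ "\<lambda>f. cinner f h"]) blast
  next
    assume "complex_vector.dim (joint_eigenspace S T l m) = 0"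
    then have "B = {}"
      using B(3) fin(2) by simp
    note mult = eval_op_mult[OF lin commute]
    note Lin = eval_op_clinear[OF lin]
    have row: "(\<Sum>f\<in>D. eval_op (K r f) S T f) = 0" if "r \<in> R" for r
      using that \<open>B = {}\<close> by (auto simp: R_def K_def pencil_relation[OF D])
    have N0: "(\<Sum>f\<in>D. eval_op (N e f) S T f) = 0" for e
    proof -
      have "(\<Sum>f\<in>D. eval_op (N e f) S T f)
          = (\<Sum>r\<in>R. cnj (eval2 (K r e) l m) *\<^sub>C (\<Sum>f\<in>D. eval_op (K r f) S T f))"
        unfolding N_def eval_op_sum mult eval_op_const complex_vector.scale_sum_right
        by (rule sum.swap)
      then show ?thesis
        by (simp add: row)
    qed
    have \<Delta>0: "eval_op \<Delta> S T e = 0" if e: "e \<in> D" for e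
    proof -
      have "eval_op \<Delta> S T e = (\<Sum>f\<in>D. if e = f then eval_op \<Delta> S T f else 0)"
        using fin e by simp
      also have "\<dots> = (\<Sum>f\<in>D. eval_op (\<Sum>g\<in>D. adj e g * N g f) S T f)"
        by (rule sum.cong) (simp_all add: adj e)
      also have "\<dots> = (\<Sum>g\<in>D. eval_op (adj e g) S T (\<Sum>f\<in>D. eval_op (N g f) S T f))"
        unfolding eval_op_sum mult clinear_sum[OF Lin] by (rule sum.swap)
      also have "\<dots> = 0"
        by (simp add: N0 clinear_zero[OF Lin])
      finally show ?thesis .
    qed
    obtain k where k: "\<And>x. norm (eval_op \<Delta> S T x) \<le> k * norm x"
      using eval_op_bounded[OF isometries] by blast
    note \<Delta>_adjoint = cadjoint_bounded[OF Lin k]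
    have \<Delta>_pow: "eval_op \<Delta> S T (((S \<circ> T) ^^ n) x) = ((S \<circ> T) ^^ n) (eval_op \<Delta> S T x)" for n x
      by (rule eval_op_commute[OF funpow_clinear[OF isometry_clinear[OF isometry_product]], symmetric])
        (induction n; simp add: commute)+
    have "cadjoint (eval_op \<Delta> S T) y = 0" for y
    proof (rule wandering_cyclic[OF D(2)])
      fix n d
      assume d: "d \<in> D"
      show "cinner (((S \<circ> T) ^^ n) d) (cadjoint (eval_op \<Delta> S T) y) = 0"
        unfolding \<Delta>_adjoint[symmetric] \<Delta>_pow \<Delta>0[OF d]
          clinear_zero[OF funpow_clinear[OF isometry_clinear[OF isometry_product]]]
        by (rule cinner_zero_left)
    qed
    then have "cinner (eval_op \<Delta> S T x) y = 0" for x y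
      by (simp add: \<Delta>_adjoint)
    then have "eval_op \<Delta> S T x = 0" for x
      by (metis cinner_eq_0_self)
    then show "eval_op \<Delta> S T = (\<lambda>x. 0)"
      by blast
  qed
qed

end

section \<open>Zeros of polynomials near a simple zero\<close>

text \<open>If all zeros have modulus at least \<open>R\<close>, the logarithmic derivative at \<open>0\<close>, being minus the sum of the
  reciprocals of the zeros, has modulus at most \<open>degree g / R\<close>.\<close>

lemma roots_outside_disc:
  fixes g :: "complex poly"
  assumes R: "R > 0" and roots: "\<And>x. poly g x = 0 \<Longrightarrow> R \<le> cmod x"
  shows "R * cmod (coeff g 1) \<le> real (degree g) * cmod (coeff g 0)"
  using roots
proof (induction "degree g" arbitrary: g)
  case 0
  then show ?case
    by (simp add: coeff_eq_0)
next
  case (Suc n)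
  then have "\<not> constant (poly g)"
    by (simp add: constant_degree)
  then obtain r where r: "poly g r = 0"
    using fundamental_theorem_of_algebra by blast
  then obtain h where h: "g = [:- r, 1:] * h"
    unfolding poly_eq_0_iff_dvd by (elim dvdE)
  have "h \<noteq> 0"
    using Suc.hyps(2) h by auto
  then have deg: "degree g = Suc (degree h)"
    unfolding h by (subst degree_mult_eq) auto
  have "poly h x = 0 \<Longrightarrow> R \<le> cmod x" for x
    using Suc.prems[of x] by (simp add: h)
  then have IH: "R * cmod (coeff h 1) \<le> real n * cmod (coeff h 0)"
    using Suc.hyps deg by (metis Suc_inject)
  have "R \<le> cmod r"
    using Suc.prems r by blast
  have c0: "coeff g 0 = - r * coeff h 0" and c1: "coeff g 1 = coeff h 0 - r * coeff h 1"
    by (simp_all add: h)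
  have "R * cmod (coeff g 1) \<le> R * (cmod (coeff h 0) + cmod r * cmod (coeff h 1))"
    using R norm_triangle_ineq4[of "coeff h 0" "r * coeff h 1"] unfolding c1
    by (intro mult_left_mono) (simp_all add: norm_mult)
  also have "\<dots> = R * cmod (coeff h 0) + cmod r * (R * cmod (coeff h 1))"
    by (simp add: algebra_simps)
  also have "\<dots> \<le> cmod r * cmod (coeff h 0) + cmod r * (real n * cmod (coeff h 0))"
    using \<open>R \<le> cmod r\<close> IH by (intro add_mono mult_right_mono mult_left_mono) simp_all
  also have "\<dots> = real (degree g) * cmod (coeff g 0)"
    using Suc.hyps(2) by (simp add: c0 norm_mult algebra_simps flip: Suc.hyps(2))
  finally show ?case .
qed

lemma pderiv_sum: "pderiv (\<Sum>i\<in>I. f i) = (\<Sum>i\<in>I. pderiv (f i))"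
  by (induction I rule: infinite_finite_induct) (simp_all add: pderiv_add)

text \<open>The contrapositive at an arbitrary point \<open>m\<close>; the summand \<open>e\<close> keeps the radius positive when
  \<open>m\<close> is itself a zero.\<close>

lemma root_near_point:
  fixes q :: "complex poly"
  assumes deg: "degree q \<le> J" and nz: "poly (pderiv q) m \<noteq> 0" and e: "e > 0"
  shows "\<exists>x. poly q x = 0 \<and> cmod (x - m) \<le> real J * cmod (poly q m) / cmod (poly (pderiv q) m) + e"
proof (rule ccontr)
  define R where "R = real J * cmod (poly q m) / cmod (poly (pderiv q) m) + e"
  define g where "g = pcompose q [:m, 1:]"
  assume "\<not> ?thesis"
  then have far: "R < cmod (x - m)" if "poly q x = 0" for x
    using that unfolding R_def by force
  have "R > 0"
    unfolding R_def using e by (simp add: add_nonneg_pos)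
  have g0: "coeff g 0 = poly q m"
    by (simp add: g_def poly_0_coeff_0[symmetric] poly_pcompose)
  have "poly (pderiv g) 0 = poly (pderiv q) m"
    by (simp add: g_def pderiv_pcompose poly_pcompose pderiv_pCons)
  then have g1: "coeff g 1 = poly (pderiv q) m"
    by (simp add: poly_0_coeff_0 coeff_pderiv)
  have "R * cmod (coeff g 1) \<le> real (degree g) * cmod (coeff g 0)"
  proof (rule roots_outside_disc[OF \<open>R > 0\<close>])
    fix x
    assume "poly g x = 0"
    then show "R \<le> cmod x"
      using far[of "m + x"] by (simp add: g_def poly_pcompose)
  qed
  also have "\<dots> \<le> real J * cmod (poly q m)"
    using deg by (simp add: g0 g_def degree_pcompose mult_right_mono)
  finally have "e * cmod (poly (pderiv q) m) \<le> 0"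
    using nz unfolding g1 R_def by (simp add: distrib_right)
  then show False
    using e nz by (simp add: mult_le_0_iff)
qed

section \<open>Eigenspaces near a regular point\<close>

lemma bounded_bilinear_scaleC:
  "bounded_bilinear (scaleC :: complex \<Rightarrow> 'a::complex_inner \<Rightarrow> 'a)"
  by unfold_locales
    (auto simp: scaleC_add_left scaleC_add_right scaleR_scaleC scaleC_scaleC norm_scaleC
      mult.commute scaleR_conv_of_real intro!: exI[of _ 1])

lemmas tendsto_scaleC = bounded_bilinear.tendsto[OF bounded_bilinear_scaleC]

lemma tendsto_cadjoint_isometry:
  assumes A: "isometry A" and lim: "(f \<longlongrightarrow> x) F"
  shows "((\<lambda>n. cadjoint A (f n)) \<longlongrightarrow> cadjoint A x) F"
proof (rule LIM_zero_cancel, rule Lim_null_comparison)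
  show "\<forall>\<^sub>F n in F. norm (cadjoint A (f n) - cadjoint A x) \<le> norm (f n - x)"
    using norm_cadjoint_isometry[OF A]
    by (intro always_eventually allI) (metis clinear_diff[OF cadjoint_isometry_clinear[OF A]])
  show "((\<lambda>n. norm (f n - x)) \<longlongrightarrow> 0) F"
    using lim by (intro tendsto_norm_zero LIM_zero)
qed

text \<open>The value at \<open>h\<close> of \<open>(A\<^sup>j - b\<^sup>j) / (A - b)\<close>.\<close>

primrec power_quotient ::
  "('a::complex_inner \<Rightarrow> 'a) \<Rightarrow> complex \<Rightarrow> nat \<Rightarrow> 'a \<Rightarrow> 'a" where
  "power_quotient A b 0 h = 0"
| "power_quotient A b (Suc j) h = b *\<^sub>C power_quotient A b j h + (A ^^ j) h"

lemma power_quotient_mult: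
  assumes "clinear A"
  shows "A (power_quotient A b j h) - b *\<^sub>C power_quotient A b j h = (A ^^ j) h - b ^ j *\<^sub>C h"
proof (induction j)
  case (Suc j)
  have "A (power_quotient A b (Suc j) h) - b *\<^sub>C power_quotient A b (Suc j) h
      = b *\<^sub>C (A (power_quotient A b j h) - b *\<^sub>C power_quotient A b j h)
        + (A ((A ^^ j) h) - b *\<^sub>C (A ^^ j) h)"
    by (simp add: clinear_add[OF assms] clinear_scaleC[OF assms] scaleC_add_right
        complex_vector.scale_right_diff_distrib)
  then show ?case
    unfolding Suc by (simp add: complex_vector.scale_right_diff_distrib scaleC_scaleC)
qed (simp add: clinear_zero[OF assms])

lemma power_quotient_eigenvector:
  fixes A :: "'a::complex_inner \<Rightarrow> 'a"
  assumes "clinear A" "A h = b *\<^sub>C h"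
  shows "power_quotient A b j h = (of_nat j * b ^ (j - 1)) *\<^sub>C h"
proof (induction j)
  case (Suc j)
  have "(A ^^ j) h = b ^ j *\<^sub>C h"
    by (induction j) (simp_all add: assms clinear_scaleC scaleC_scaleC mult.commute)
  moreover have "b * (of_nat j * b ^ (j - 1)) + b ^ j = of_nat (Suc j) * b ^ (Suc j - 1)"
    by (cases j) (simp_all add: algebra_simps)
  ultimately show ?case
    by (simp only: power_quotient.simps Suc scaleC_scaleC scaleC_add_left[symmetric])
qed simp

lemma power_quotient_commuting_eigenvector:
  fixes A :: "'a::complex_inner \<Rightarrow> 'a"
  assumes "clinear B" "\<And>x. B (A x) = A (B x)" "clinear A" "B h = a *\<^sub>C h"
  shows "B (power_quotient A b j h) = a *\<^sub>C power_quotient A b j h"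
proof (induction j)
  case (Suc j)
  have "B ((A ^^ j) h) = a *\<^sub>C (A ^^ j) h"
    by (induction j) (simp_all add: assms clinear_scaleC)
  then show ?case
    using Suc
    by (simp add: clinear_add[OF assms(1)] clinear_scaleC[OF assms(1)] scaleC_add_right scaleC_scaleC
        mult.commute)
qed (simp add: clinear_zero[OF assms(1)])

lemma power_quotient_tendsto:
  assumes A: "isometry A" and b: "(b \<longlongrightarrow> b0) F" and h: "(h \<longlongrightarrow> h0) F"
  shows "((\<lambda>n. power_quotient (cadjoint A) (b n) j (h n)) \<longlongrightarrow> power_quotient (cadjoint A) b0 j h0) F"
proof (induction j)
  case (Suc j)
  have "((\<lambda>n. (cadjoint A ^^ j) (h n)) \<longlongrightarrow> (cadjoint A ^^ j) h0) F"
    by (induction j) (simp_all add: h tendsto_cadjoint_isometry[OF A])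
  then show ?case
    using Suc by (auto intro!: tendsto_add tendsto_scaleC b)
qed simp

context finite_isopair
begin

text \<open>Let \<open>f(z, w)\<close> be a polynomial with \<open>f(S, T) = 0\<close> that has a zero at \<open>(l0, m0)\<close> with
  \<open>\<partial>f/\<partial>w \<noteq> 0\<close>. For \<open>l\<close> near \<open>l0\<close> there is a zero \<open>(l, m)\<close> of \<open>f\<close> near \<open>(l0, m0)\<close>. The
  resolvent carries an eigenvector \<open>h\<close> of \<open>S\<^sup>*\<close> from \<open>l0\<close> to \<open>l\<close>, and since \<open>f(l, T)\<^sup>*\<close>
  annihilates it, the adjoint of \<open>f(l, w) / (w - m)\<close> at \<open>T\<close> maps it into the
  joint eigenspace. At \<open>(l0, m0)\<close> this map is a multiplication by the conjugate of
  \<open>\<partial>f/\<partial>w\<close>, so the resulting vectors stay independent.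
  The polynomial is given by its coefficients to keep the roles of \<open>S\<close> and \<open>T\<close> symmetric.\<close>

lemma eigenspaces_near_regular_point:
  fixes c :: "nat \<Rightarrow> nat \<Rightarrow> complex"
  assumes annihilates: "\<And>x. (\<Sum>j\<le>J. \<Sum>i\<le>I. c i j *\<^sub>C (S ^^ i) ((T ^^ j) x)) = 0"
    and zero: "(\<Sum>j\<le>J. \<Sum>i\<le>I. c i j * l0 ^ i * m0 ^ j) = 0"
    and regular: "(\<Sum>j\<le>J. \<Sum>i\<le>I. c i j * l0 ^ i * (of_nat j * m0 ^ (j - 1))) \<noteq> 0"
    and l0: "cmod l0 < 1"
    and U: "open U" "(l0, m0) \<in> U"
  shows "infinite {(z, w). (z, w) \<in> U \<and> (\<Sum>j\<le>J. \<Sum>i\<le>I. c i j * z ^ i * w ^ j) = 0 \<and>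
    complex_vector.dim (joint_eigenspace S T l0 m0) \<le> complex_vector.dim (joint_eigenspace S T z w)}"
proof -
  define C where "C j z = (\<Sum>i\<le>I. c i j * z ^ i)" for j z
  have f_eq: "(\<Sum>j\<le>J. \<Sum>i\<le>I. c i j * z ^ i * w ^ j) = (\<Sum>j\<le>J. C j z * w ^ j)" for z w
    by (simp add: C_def sum_distrib_right)
  define d where "d z = (\<Sum>j\<le>J. C j z * (of_nat j * m0 ^ (j - 1)))" for z
  have d0: "d l0 \<noteq> 0"
    using regular by (simp add: d_def C_def sum_distrib_right)
  have f0: "(\<Sum>j\<le>J. C j l0 * m0 ^ j) = 0"
    using zero by (simp only: f_eq)
  define q where "q z = (\<Sum>j\<le>J. monom (C j z) j)" for z
  have poly_q: "poly (q z) w = (\<Sum>j\<le>J. C j z * w ^ j)" for z w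
    by (simp add: q_def poly_sum poly_monom)
  have pderiv_q: "poly (pderiv (q z)) m0 = d z" for z
    by (simp add: q_def pderiv_sum poly_sum pderiv_monom poly_monom d_def mult_ac)
  have deg_q: "degree (q z) \<le> J" for z
    unfolding q_def
    by (rule degree_sum_le) (auto intro: order_trans[OF degree_monom_le])
  define l where "l n = l0 + of_real (1 / real (Suc n))" for n
  have inv: "(\<lambda>n. 1 / real (Suc n)) \<longlonglongrightarrow> 0"
    using LIMSEQ_inverse_real_of_nat by (simp add: inverse_eq_divide)
  have l_lim: "l \<longlonglongrightarrow> l0"
  proof -
    have "l \<longlonglongrightarrow> l0 + of_real 0"
      unfolding l_def by (intro tendsto_intros inv)
    then show ?thesis
      by simp
  qed
  have l_inj: "l n = l k \<longleftrightarrow> n = k" for n k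
    by (auto simp: l_def)
  have C_lim: "(\<lambda>n. C j (l n)) \<longlonglongrightarrow> C j l0" for j
    unfolding C_def by (intro tendsto_intros l_lim)
  have d_lim: "(\<lambda>n. d (l n)) \<longlonglongrightarrow> d l0"
    unfolding d_def by (intro tendsto_intros C_lim)
  define r where "r n = real J * cmod (poly (q (l n)) m0) / cmod (d (l n)) + 1 / real (Suc n)" for n
  have "r \<longlonglongrightarrow> real J * cmod (\<Sum>j\<le>J. C j l0 * m0 ^ j) / cmod (d l0) + 0"
    unfolding r_def poly_q by (intro tendsto_intros C_lim d_lim inv) (use d0 in simp)
  then have r_lim: "r \<longlonglongrightarrow> 0"
    by (simp add: f0)
  have "\<exists>x. d (l n) \<noteq> 0 \<longrightarrow> poly (q (l n)) x = 0 \<and> cmod (x - m0) \<le> r n" for n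
    using root_near_point[OF deg_q, of "l n" m0 "1 / real (Suc n)"] by (auto simp: pderiv_q r_def)
  then obtain m where m: "\<And>n. d (l n) \<noteq> 0 \<Longrightarrow> poly (q (l n)) (m n) = 0 \<and> cmod (m n - m0) \<le> r n"
    by metis
  have d_ev: "\<forall>\<^sub>F n in sequentially. d (l n) \<noteq> 0"
    by (rule tendsto_imp_eventually_ne[OF d_lim d0])
  have m_lim: "m \<longlonglongrightarrow> m0"
  proof (rule LIM_zero_cancel, rule Lim_null_comparison[OF _ r_lim])
    show "\<forall>\<^sub>F n in sequentially. norm (m n - m0) \<le> r n"
      using d_ev by eventually_elim (use m in simp)
  qed
  have l_ev: "\<forall>\<^sub>F n in sequentially. cmod (l n) < 1"
    by (rule order_tendstoD(2)[OF tendsto_norm[OF l_lim] l0])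
  have U_ev: "\<forall>\<^sub>F n in sequentially. (l n, m n) \<in> U"
    using topological_tendstoD[OF tendsto_Pair[OF l_lim m_lim] U] .
  obtain G where G: "finite G" "joint_eigenspace S T l0 m0 \<subseteq> complex_vector.span G"
    by (rule joint_eigenspace_finite[OF l0])
  obtain B where B: "orthonormal B" "complex_vector.span B = joint_eigenspace S T l0 m0"
    "card B = complex_vector.dim (joint_eigenspace S T l0 m0)"
    by (rule orthonormal_basis_exists[OF joint_eigenspace_subspace G])
  have finB: "finite B"
    using B(1) by (simp add: orthonormal_def)
  define u where "u n h = resolvent S (cnj (l n)) (h - cnj l0 *\<^sub>C S h)" for n h
  \<comment> \<open>the sum is the value at \<open>T\<^sup>*\<close> of the conjugate of \<open>f(l n, w) / (w - m n)\<close>; the scalar in front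
    of it normalizes the limit of \<open>v n h\<close> to \<open>h\<close>\<close>
  define v where "v n h = (1 / cnj (d l0)) *\<^sub>C
    (\<Sum>j\<le>J. cnj (C j (l n)) *\<^sub>C power_quotient (cadjoint T) (cnj (m n)) j (u n h))" for n h
  have v_eigen: "v n h \<in> joint_eigenspace S T (l n) (m n)"
    if n: "d (l n) \<noteq> 0" "cmod (l n) < 1" and h: "h \<in> joint_eigenspace S T l0 m0" for n h
  proof -
    let ?h = "u n h"
    have "cadjoint S (h - cnj l0 *\<^sub>C S h) = 0"
      using h by (intro eigenvector_residual isometries) (simp add: joint_eigenspace_def)
    then have Sh: "cadjoint S ?h = cnj (l n) *\<^sub>C ?h"
      unfolding u_def using n(2) by (intro resolvent_eigenvector isometries) simp_all
    have f_adjoint: "(\<Sum>j\<le>J. cnj (C j (l n)) *\<^sub>C (cadjoint T ^^ j) ?h) = 0"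
    proof (rule cinner_right_ext)
      fix x
      have "cinner x (\<Sum>j\<le>J. cnj (C j (l n)) *\<^sub>C (cadjoint T ^^ j) ?h)
          = cinner (\<Sum>j\<le>J. \<Sum>i\<le>I. c i j *\<^sub>C (S ^^ i) ((T ^^ j) x)) ?h"
        by (simp add: cinner_sum_right cinner_sum_left cinner_scaleC_right cinner_scaleC_left
            cinner_funpow_eigenvector[OF isometries(1) Sh] cinner_funpow_cadjoint[OF isometries(2)]
            C_def sum_distrib_right mult.assoc)
      then show "cinner x (\<Sum>j\<le>J. cnj (C j (l n)) *\<^sub>C (cadjoint T ^^ j) ?h) = cinner x 0"
        by (simp add: annihilates)
    qed
    define y where
      "y = (\<Sum>j\<le>J. cnj (C j (l n)) *\<^sub>C power_quotient (cadjoint T) (cnj (m n)) j ?h)"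
    have "cadjoint T y - cnj (m n) *\<^sub>C y
        = (\<Sum>j\<le>J. cnj (C j (l n)) *\<^sub>C ((cadjoint T ^^ j) ?h - cnj (m n) ^ j *\<^sub>C ?h))"
      unfolding power_quotient_mult[OF adjoint_lin(2), symmetric]
      by (simp add: y_def clinear_sum[OF adjoint_lin(2)] clinear_scaleC[OF adjoint_lin(2)]
          complex_vector.scale_sum_right complex_vector.scale_right_diff_distrib sum_subtractf
          scaleC_scaleC mult.commute)
    also have "\<dots> = - (cnj (\<Sum>j\<le>J. C j (l n) * m n ^ j) *\<^sub>C ?h)"
      by (simp add: complex_vector.scale_right_diff_distrib sum_subtractf f_adjoint scaleC_scaleC
          complex_vector.scale_sum_left)
    also have "(\<Sum>j\<le>J. C j (l n) * m n ^ j) = 0"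
      using m[OF n(1)] by (simp add: poly_q)
    finally have Ty: "cadjoint T y = cnj (m n) *\<^sub>C y"
      by simp
    have Sy: "cadjoint S y = cnj (l n) *\<^sub>C y"
      using power_quotient_commuting_eigenvector[OF adjoint_lin(1) adjoint_commute adjoint_lin(2) Sh]
      by (simp add: y_def clinear_sum[OF adjoint_lin(1)] clinear_scaleC[OF adjoint_lin(1)]
          complex_vector.scale_sum_right scaleC_scaleC mult.commute)
    have "y \<in> joint_eigenspace S T (l n) (m n)"
      by (simp add: joint_eigenspace_def Sy Ty)
    then show ?thesis
      unfolding v_def y_def by (rule complex_vector.subspace_scale[OF joint_eigenspace_subspace])
  qed
  have v_lim: "(\<lambda>n. v n h) \<longlonglongrightarrow> h" if h: "h \<in> joint_eigenspace S T l0 m0" for h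
  proof -
    have l0': "cmod (cnj l0) < 1"
      using l0 by simp
    have "(\<lambda>n. u n h) \<longlonglongrightarrow> resolvent S (cnj l0) (h - cnj l0 *\<^sub>C S h)"
      unfolding u_def by (intro resolvent_tendsto isometries l0' tendsto_intros l_lim)
    also have "resolvent S (cnj l0) (h - cnj l0 *\<^sub>C S h) = h"
      by (rule resolvent_unique[OF isometries(1) l0' refl, symmetric])
    finally have u_lim: "(\<lambda>n. u n h) \<longlonglongrightarrow> h" .
    have "(\<lambda>n. v n h) \<longlonglongrightarrow> (1 / cnj (d l0)) *\<^sub>C
        (\<Sum>j\<le>J. cnj (C j l0) *\<^sub>C power_quotient (cadjoint T) (cnj m0) j h)"
      unfolding v_def
      by (intro tendsto_scaleC tendsto_sum tendsto_const power_quotient_tendsto isometries u_lim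
          tendsto_cnj m_lim C_lim)
    also have "(\<Sum>j\<le>J. cnj (C j l0) *\<^sub>C power_quotient (cadjoint T) (cnj m0) j h) = cnj (d l0) *\<^sub>C h"
    proof -
      have "cadjoint T h = cnj m0 *\<^sub>C h"
        using h by (simp add: joint_eigenspace_def)
      then show ?thesis
        by (simp add: power_quotient_eigenvector[OF adjoint_lin(2)] scaleC_scaleC d_def
            complex_vector.scale_sum_left)
    qed
    also have "(1 / cnj (d l0)) *\<^sub>C cnj (d l0) *\<^sub>C h = h"
      using d0 by (simp add: scaleC_scaleC scaleC_one)
    finally show ?thesis .
  qed
  have "\<forall>\<^sub>F n in sequentially. \<forall>b\<in>B. norm (v n b - b) < 1 / (real (card B) + 1)"
  proof (rule eventually_ball_finite[OF finB], rule ballI)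
    fix b
    assume "b \<in> B"
    then have "(\<lambda>n. v n b) \<longlonglongrightarrow> b"
      using v_lim B(2) complex_vector.span_base by blast
    then show "\<forall>\<^sub>F n in sequentially. norm (v n b - b) < 1 / (real (card B) + 1)"
      using tendstoD[of _ b _ "1 / (real (card B) + 1)"] by (simp add: dist_norm)
  qed
  then have "\<forall>\<^sub>F n in sequentially. (l n, m n) \<in> U \<and> (\<Sum>j\<le>J. C j (l n) * m n ^ j) = 0 \<and>
    complex_vector.dim (joint_eigenspace S T l0 m0)
      \<le> complex_vector.dim (joint_eigenspace S T (l n) (m n))"
    using U_ev d_ev l_ev
  proof eventually_elim
    case (elim n)
    obtain G where G: "finite G" "joint_eigenspace S T (l n) (m n) \<subseteq> complex_vector.span G"
      by (rule joint_eigenspace_finite[OF elim(4)])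
    have "v n ` B \<subseteq> joint_eigenspace S T (l n) (m n)"
      using v_eigen[OF elim(3,4)] B(2) complex_vector.span_base by blast
    then have "card B \<le> complex_vector.dim (joint_eigenspace S T (l n) (m n))"
      using perturbed_orthonormal_dim[OF B(1) _ _ G] elim(1) by blast
    then show ?case
      using elim(2) m[OF elim(3)] B(3) by (simp add: poly_q)
  qed
  then obtain N where N: "\<And>n. n \<ge> N \<Longrightarrow> (l n, m n) \<in> U \<and> (\<Sum>j\<le>J. C j (l n) * m n ^ j) = 0 \<and>
    complex_vector.dim (joint_eigenspace S T l0 m0)
      \<le> complex_vector.dim (joint_eigenspace S T (l n) (m n))"
    unfolding eventually_sequentially by blast
  have "infinite ((\<lambda>n. (l n, m n)) ` {N..})"
    by (subst finite_image_iff) (auto simp: inj_on_def l_inj infinite_Ici)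
  then show ?thesis
    by (rule infinite_super[rotated]) (use N in \<open>auto simp: f_eq\<close>)
qed

end

section \<open>Common zeros of coprime bivariate polynomials\<close>

text \<open>In the ideal generated by \<open>P\<close> and \<open>Q\<close>, an element \<open>m\<close> of least degree in \<open>w\<close> pseudo-divides
  both. If \<open>m\<close> had positive degree, then the prime \<open>P\<close> would divide \<open>m\<close> and hence \<open>Q\<close>. So \<open>m\<close> is a
  polynomial in \<open>z\<close> alone.\<close>

lemma common_zeros_eliminate:
  fixes P Q :: bipoly
  assumes P: "irreducible P" "degree P > 0" and nd: "\<not> P dvd Q"
  obtains g where "g \<noteq> 0"
    "\<And>z w. eval2 P z w = 0 \<Longrightarrow> eval2 Q z w = 0 \<Longrightarrow> poly g z = 0"
proof -
  have prime: "prime_elem P"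
    by (rule irreducible_imp_prime_elem[OF P(1)])
  define ideal where "ideal m \<longleftrightarrow> (\<exists>u v. m = u * P + v * Q)" for m
  have P_ideal: "ideal P" and Q_ideal: "ideal Q"
    unfolding ideal_def
    by (intro exI[of _ 1] exI[of _ 0], simp) (intro exI[of _ 0] exI[of _ 1], simp)
  have "P \<noteq> 0"
    using P(2) by auto
  then obtain m where m: "ideal m" "m \<noteq> 0" "\<And>k. ideal k \<Longrightarrow> k \<noteq> 0 \<Longrightarrow> degree m \<le> degree k"
    using ex_has_least_nat[of "\<lambda>m. ideal m \<and> m \<noteq> 0" P degree] P_ideal by blast
  have divides: "\<exists>a t. a \<noteq> 0 \<and> smult a f = m * t" if f: "ideal f" for f
  proof -
    obtain t r where tr: "pseudo_divmod f m = (t, r)"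
      by force
    define a where "a = lead_coeff m ^ (Suc (degree f) - degree m)"
    have eq: "smult a f = m * t + r" and deg: "r = 0 \<or> degree r < degree m"
      using pseudo_divmod[OF m(2) tr] by (simp_all add: a_def)
    have "ideal r"
    proof -
      obtain u v u' v' where "f = u * P + v * Q" "m = u' * P + v' * Q"
        using f m(1) unfolding ideal_def by blast
      then have "r = ([:a:] * u - t * u') * P + ([:a:] * v - t * v') * Q"
        using eq by (simp add: algebra_simps smult_add_right)
      then show ?thesis
        unfolding ideal_def by blast
    qed
    then have "r = 0"
      using deg m(3) by fastforce
    moreover have "a \<noteq> 0"
      using m(2) by (simp add: a_def)
    ultimately show ?thesis
      using eq by auto
  qed
  obtain a t where at: "a \<noteq> 0" "smult a P = m * t"
    using divides[OF P_ideal] by blast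
  obtain b s where bs: "b \<noteq> 0" "smult b Q = m * s"
    using divides[OF Q_ideal] by blast
  have not_const: "\<not> P dvd [:c:]" if "c \<noteq> 0" for c
    using dvd_imp_degree_le[of P "[:c:]"] that P(2) by auto
  have "degree m = 0"
  proof -
    have "P dvd m * t"
      by (metis at(2) dvd_smult dvd_refl)
    then consider "P dvd m" | "P dvd t"
      using prime prime_elem_dvd_mult_iff by blast
    then show ?thesis
    proof cases
      case 1
      then have "P dvd [:b:] * Q"
        using bs(2) by simp
      then show ?thesis
        using prime_elem_dvd_mult_iff[OF prime] not_const[OF bs(1)] nd by blast
    next
      case 2
      then obtain t' where "t = P * t'"
        by (elim dvdE)
      then have "P * [:a:] = P * (m * t')"
        using at(2) by (simp add: algebra_simps)
      then have "[:a:] = m * t'"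
        using \<open>P \<noteq> 0\<close> unfolding mult_cancel_left by blast
      then have "m dvd [:a:]"
        by (rule dvdI)
      then have "degree m \<le> degree [:a:]"
        by (rule dvd_imp_degree_le) (use at(1) in simp)
      then show ?thesis
        by simp
    qed
  qed
  then obtain g where g: "m = [:g:]"
    by (elim degree_eq_zeroE)
  show thesis
  proof (rule that)
    show "g \<noteq> 0"
      using m(2) g by simp
    fix z w
    assume zero: "eval2 P z w = 0" "eval2 Q z w = 0"
    obtain u v where "m = u * P + v * Q"
      using m(1) unfolding ideal_def by blast
    then have "eval2 m z w = 0"
      by (simp add: eval2_add eval2_mult zero)
    then show "poly g z = 0"
      by (simp add: g eval2_def)
  qed
qed

section \<open>Coefficient expansions and partial derivatives\<close>

lemma eval2_bound:
  assumes "degree p \<le> J"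
  shows "eval2 p z w = (\<Sum>j\<le>J. poly (coeff p j) z * w ^ j)"
proof -
  have "eval2 p z w = (\<Sum>j\<le>degree p. poly (coeff p j) z * w ^ j)"
    by (simp add: eval2_def poly_altdef[of p] poly_sum)
  also have "\<dots> = (\<Sum>j\<le>J. poly (coeff p j) z * w ^ j)"
    by (rule sum.mono_neutral_left) (use assms in \<open>auto simp: coeff_eq_0\<close>)
  finally show ?thesis .
qed

lemma poly_bound:
  fixes r :: "complex poly"
  assumes "degree r \<le> I"
  shows "poly r z = (\<Sum>i\<le>I. coeff r i * z ^ i)"
    and "poly (pderiv r) z = (\<Sum>i\<le>I. coeff r i * (of_nat i * z ^ (i - 1)))"
proof -
  have r: "(\<Sum>i\<le>I. monom (coeff r i) i) = r"
    by (rule poly_as_sum_of_monoms'[OF assms])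
  show "poly r z = (\<Sum>i\<le>I. coeff r i * z ^ i)"
    using arg_cong[OF r, of "\<lambda>r. poly r z"] by (simp add: poly_sum poly_monom)
  show "poly (pderiv r) z = (\<Sum>i\<le>I. coeff r i * (of_nat i * z ^ (i - 1)))"
    using arg_cong[OF r, of "\<lambda>r. poly (pderiv r) z"]
    by (simp add: poly_sum poly_monom pderiv_sum pderiv_monom mult_ac)
qed

lemma partial_derivative_expansions:
  assumes I: "\<And>j. degree (coeff p j) \<le> I"
  shows "eval2 p z w = (\<Sum>j\<le>degree p. \<Sum>i\<le>I. coeff (coeff p j) i * z ^ i * w ^ j)"
    and "eval2 (partial_w p) z w
      = (\<Sum>j\<le>degree p. \<Sum>i\<le>I. coeff (coeff p j) i * z ^ i * (of_nat j * w ^ (j - 1)))"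
    and "eval2 (partial_z p) z w
      = (\<Sum>j\<le>degree p. \<Sum>i\<le>I. coeff (coeff p j) i * w ^ j * (of_nat i * z ^ (i - 1)))"
proof -
  show "eval2 p z w = (\<Sum>j\<le>degree p. \<Sum>i\<le>I. coeff (coeff p j) i * z ^ i * w ^ j)"
    by (simp add: eval2_bound[OF order_refl] poly_bound(1)[OF I] sum_distrib_right)
  have "pderiv p = (\<Sum>j\<le>degree p. monom (of_nat j * coeff p j) (j - 1))"
    using arg_cong[OF poly_as_sum_of_monoms[of p], of pderiv]
    by (simp add: pderiv_sum pderiv_monom)
  moreover have "eval2 (monom r j) z w = poly r z * w ^ j" for r j
    by (simp add: eval2_def poly_monom)
  ultimately show "eval2 (partial_w p) z w
      = (\<Sum>j\<le>degree p. \<Sum>i\<le>I. coeff (coeff p j) i * z ^ i * (of_nat j * w ^ (j - 1)))"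
    by (simp add: partial_w_def eval2_sum poly_bound(1)[OF I] sum_distrib_right sum_distrib_left
        mult_ac)
  show "eval2 (partial_z p) z w
      = (\<Sum>j\<le>degree p. \<Sum>i\<le>I. coeff (coeff p j) i * w ^ j * (of_nat i * z ^ (i - 1)))"
    by (simp add: partial_z_def eval2_bound[OF map_poly_degree_leq] coeff_map_poly
        poly_bound(2)[OF I] sum_distrib_left mult_ac)
qed

lemma DERIV_eval2_first:
  "((\<lambda>z. eval2 p z w) has_field_derivative eval2 (partial_z p) z w) (at z)"
proof (induction p)
  case (pCons a p)
  have "partial_z (pCons a p) = pCons (pderiv a) (partial_z p)"
    by (simp add: partial_z_def map_poly_pCons)
  then show ?case
    unfolding eval2_pCons
    by (auto simp: eval2_pCons intro!: derivative_eq_intros pCons.IH poly_DERIV)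
qed (simp add: partial_z_def)

lemma partial_derivatives_mult_zero:
  assumes "eval2 p z w = 0" "eval2 q z w = 0"
  shows "eval2 (partial_z (p * q)) z w = 0" "eval2 (partial_w (p * q)) z w = 0"
proof -
  have "((\<lambda>z. eval2 p z w * eval2 q z w) has_field_derivative
      (eval2 (partial_z p) z w * eval2 q z w + eval2 (partial_z q) z w * eval2 p z w)) (at z)"
    by (intro DERIV_mult DERIV_eval2_first)
  then show "eval2 (partial_z (p * q)) z w = 0"
    using DERIV_eval2_first[of "p * q" w z] assms by (simp add: eval2_mult DERIV_unique)
  show "eval2 (partial_w (p * q)) z w = 0"
    by (simp add: partial_w_def pderiv_mult eval2_add eval2_mult assms)
qed

lemma continuous_eval2: "continuous_on UNIV (\<lambda>x. eval2 p (fst x) (snd x))"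
  by (induction p) (auto simp: eval2_pCons intro!: continuous_intros)

text \<open>An inner toral polynomial does not vanish identically on a line \<open>z = z0\<close> with \<open>\<bar>z0\<bar> < 1\<close>,
  since it has no zero \<open>(z0, 2)\<close>.\<close>

lemma inner_toral_finite_common_zeros:
  assumes P: "irreducible P" "inner_toral P" and nd: "\<not> P dvd Q"
  shows "finite {(z, w). cmod z < 1 \<and> eval2 P z w = 0 \<and> eval2 Q z w = 0}"
proof -
  have nz: "eval2 P z 2 \<noteq> 0" if "cmod z < 1" for z
    using subsetD[OF P(2)[unfolded inner_toral_def], of "(z, 2)"] that by (auto simp: zero_set_def)
  show ?thesis
  proof (cases "degree P = 0")
    case True
    then obtain r where "P = [:r:]"
      by (elim degree_eq_zeroE)
    then have "{(z, w). cmod z < 1 \<and> eval2 P z w = 0 \<and> eval2 Q z w = 0} = {}"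
      using nz by (auto simp: eval2_def)
    then show ?thesis
      by (simp only: finite.emptyI)
  next
    case False
    obtain g where g: "g \<noteq> 0"
      "\<And>z w. eval2 P z w = 0 \<Longrightarrow> eval2 Q z w = 0 \<Longrightarrow> poly g z = 0"
      using common_zeros_eliminate[OF P(1) _ nd] False by blast
    have fibre: "finite {w. eval2 P z w = 0}" if z: "cmod z < 1" for z
    proof -
      define R where "R = (\<Sum>j\<le>degree P. monom (poly (coeff P j) z) j)"
      have R: "poly R w = eval2 P z w" for w
        by (simp add: R_def poly_sum poly_monom eval2_bound[OF order_refl])
      then have "R \<noteq> 0"
        using nz[OF z] by (metis poly_0)
      then show ?thesis
        using poly_roots_finite[of R] by (simp add: R)
    qed
    have "finite (SIGMA z:{z. poly g z = 0} \<inter> {z. cmod z < 1}. {w. eval2 P z w = 0})"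
      using poly_roots_finite[OF g(1)] fibre by (intro finite_SigmaI) auto
    then show ?thesis
      by (rule finite_subset[rotated]) (use g(2) in auto)
  qed
qed

section \<open>Constancy of the dimension\<close>

context finite_isopair
begin

lemma eigenspaces_near_regular_zero:
  assumes annihilates: "eval_op p S T = (\<lambda>x. 0)"
    and regular: "(a, b) \<in> regular_points p"
    and ab: "cmod a < 1" "cmod b < 1"
    and U: "open U" "(a, b) \<in> U"
  shows "infinite {(z, w). (z, w) \<in> U \<and> eval2 p z w = 0 \<and>
    complex_vector.dim (joint_eigenspace S T a b) \<le> complex_vector.dim (joint_eigenspace S T z w)}"
proof -
  define I where "I = (\<Sum>j\<le>degree p. degree (coeff p j))"
  have I: "degree (coeff p j) \<le> I" for j
    by (cases "j \<le> degree p")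
      (auto simp: I_def coeff_eq_0 intro: member_le_sum[of j "{..degree p}" "\<lambda>j. degree (coeff p j)"])
  note expand = partial_derivative_expansions[OF I]
  have zero: "eval2 p a b = 0"
    and nz: "eval2 (partial_w p) a b \<noteq> 0 \<or> eval2 (partial_z p) a b \<noteq> 0"
    using regular by (auto simp: regular_points_def zero_set_def)
  have ann: "(\<Sum>j\<le>degree p. \<Sum>i\<le>I. coeff (coeff p j) i *\<^sub>C (S ^^ i) ((T ^^ j) x)) = 0" for x
    using fun_cong[OF annihilates, of x] by (simp add: eval_op_poly_op[OF order_refl] poly_op_bound[OF I])
  from nz show ?thesis
  proof
    assume "eval2 (partial_w p) a b \<noteq> 0"
    then show ?thesis
      using eigenspaces_near_regular_point[OF ann, of a b U] zero ab U unfolding expand by blast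
  next
    assume dz: "eval2 (partial_z p) a b \<noteq> 0"
    interpret swap: finite_isopair T S
      by (rule swap)
    have pow: "(S ^^ i) ((T ^^ j) x) = (T ^^ j) ((S ^^ i) x)" for i j x
    proof -
      have "S ((T ^^ j) x) = (T ^^ j) (S x)" for x
        by (induction j) (simp_all add: commute)
      then show ?thesis
        by (induction i) simp_all
    qed
    have ann': "(\<Sum>i\<le>I. \<Sum>j\<le>degree p. coeff (coeff p j) i *\<^sub>C (T ^^ j) ((S ^^ i) x)) = 0" for x
      using ann[of x] unfolding pow by (subst sum.swap)
    have "infinite {(w, z). (w, z) \<in> prod.swap -` U \<and>
        (\<Sum>i\<le>I. \<Sum>j\<le>degree p. coeff (coeff p j) i * w ^ j * z ^ i) = 0 \<and>
        complex_vector.dim (joint_eigenspace T S b a) \<le> complex_vector.dim (joint_eigenspace T S w z)}"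
    proof (rule swap.eigenspaces_near_regular_point[OF ann'])
      show "(\<Sum>i\<le>I. \<Sum>j\<le>degree p. coeff (coeff p j) i * b ^ j * a ^ i) = 0"
        using zero unfolding expand by (subst sum.swap) (simp add: mult_ac)
      show "(\<Sum>i\<le>I. \<Sum>j\<le>degree p. coeff (coeff p j) i * b ^ j * (of_nat i * a ^ (i - 1))) \<noteq> 0"
        using dz unfolding expand by (subst sum.swap)
      have "continuous_on UNIV (prod.swap :: complex \<times> complex \<Rightarrow> _)"
        unfolding prod.swap_def by (intro continuous_intros)
      then show "open (prod.swap -` U)"
        using open_vimage U(1) by blast
    qed (use ab U in auto)
    then have "infinite (prod.swap ` {(w, z). (w, z) \<in> prod.swap -` U \<and>
        (\<Sum>i\<le>I. \<Sum>j\<le>degree p. coeff (coeff p j) i * w ^ j * z ^ i) = 0 \<and>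
        complex_vector.dim (joint_eigenspace T S b a) \<le> complex_vector.dim (joint_eigenspace T S w z)})"
      by (subst finite_image_iff) simp_all
    moreover have "(\<Sum>i\<le>I. \<Sum>j\<le>degree p. coeff (coeff p j) i * w ^ j * z ^ i) = eval2 p z w" for z w
      unfolding expand by (subst sum.swap) (simp add: mult_ac)
    ultimately show ?thesis
      by (elim infinite_super[rotated]) (auto simp: joint_eigenspace_swap[of T S])
  qed
qed

lemma cdim_joint_eigenspace:
  assumes "cmod l < 1"
  shows "cdim (joint_eigenspace S T l m) = enat (complex_vector.dim (joint_eigenspace S T l m))"
proof -
  obtain G where "finite G" "joint_eigenspace S T l m \<subseteq> complex_vector.span G"
    by (rule joint_eigenspace_finite[OF assms])
  then show ?thesis
    unfolding cdim_def by auto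
qed

text \<open>The constant is the least dimension on the variety. A polynomial \<open>\<Delta>\<close> as in
  \<open>dimension_jump_polynomial\<close> at a point of least dimension is not divisible by \<open>P\<close>,
  so it has only finitely many zeros on the variety. Near a regular point there are infinitely many
  points of the variety with at least the same dimension, and at one of them \<open>\<Delta>\<close> does not vanish.\<close>

lemma regular_dimension_constant:
  assumes minimal: "minimal_polynomial p S T" and P: "irreducible P" and p: "p = P * q"
  obtains d where "d \<noteq> 0"
    "\<And>a b. (a, b) \<in> inner_variety P \<Longrightarrow> (a, b) \<in> regular_points p \<Longrightarrow>
      complex_vector.dim (joint_eigenspace S T a b) = d"
proof (cases "inner_variety P = {}")
  case True
  then show ?thesis
    using that[of 1] by simp
next
  case False
  have toral: "inner_toral P"
    using minimal unfolding minimal_polynomial_def inner_toral_def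
    by (auto simp: p zero_set_def eval2_mult)
  have annihilates: "eval_op p S T = (\<lambda>x. 0)" and divides: "\<And>r. eval_op r S T = (\<lambda>x. 0) \<Longrightarrow> p dvd r"
    using minimal by (simp_all add: minimal_polynomial_def)
  define dim where "dim x = complex_vector.dim (joint_eigenspace S T (fst x) (snd x))" for x
  obtain x where x: "x \<in> inner_variety P" and least: "\<And>y. y \<in> inner_variety P \<Longrightarrow> dim x \<le> dim y"
    using False ex_has_least_nat[of "\<lambda>x. x \<in> inner_variety P" _ dim] by blast
  have xD: "cmod (fst x) < 1" "cmod (snd x) < 1" "eval2 P (fst x) (snd x) = 0"
    using x by (auto simp: inner_variety_def zero_set_def)
  obtain \<Delta> where \<Delta>: "eval2 \<Delta> (fst x) (snd x) \<noteq> 0"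
    "\<And>z w. cmod z < 1 \<Longrightarrow> dim x < complex_vector.dim (joint_eigenspace S T z w) \<Longrightarrow> eval2 \<Delta> z w = 0"
    "dim x = 0 \<Longrightarrow> eval_op \<Delta> S T = (\<lambda>x. 0)"
    unfolding dim_def using dimension_jump_polynomial[OF xD(1,2)] by metis
  have nd: "\<not> P dvd \<Delta>"
    using \<Delta>(1) xD(3) by (auto simp: eval2_mult elim!: dvdE)
  then have "\<not> p dvd \<Delta>"
    unfolding p by (meson dvd_mult_left)
  then have "dim x \<noteq> 0"
    using \<Delta>(3) divides by blast
  moreover have "complex_vector.dim (joint_eigenspace S T a b) = dim x"
    if ab: "(a, b) \<in> inner_variety P" "(a, b) \<in> regular_points p" for a b
  proof (rule antisym)
    show "dim x \<le> complex_vector.dim (joint_eigenspace S T a b)"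
      using least[OF ab(1)] by (simp add: dim_def)
    have abD: "cmod a < 1" "cmod b < 1" "eval2 P a b = 0"
      using ab(1) by (auto simp: inner_variety_def zero_set_def)
    have q: "eval2 q a b \<noteq> 0"
      using ab(2) partial_derivatives_mult_zero[OF abD(3), of q]
      by (auto simp: regular_points_def p)
    define U where
      "U = {x. cmod (fst x) < 1} \<inter> {x. cmod (snd x) < 1} \<inter> {x. eval2 q (fst x) (snd x) \<noteq> 0}"
    have "open U"
      unfolding U_def
      by (intro open_Int open_Collect_less open_Collect_neq continuous_eval2 continuous_intros)
    moreover have "(a, b) \<in> U"
      using abD q by (simp add: U_def)
    ultimately have "infinite {(z, w). (z, w) \<in> U \<and> eval2 p z w = 0 \<and>
      complex_vector.dim (joint_eigenspace S T a b) \<le> complex_vector.dim (joint_eigenspace S T z w)}"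
      (is "infinite ?N")
      by (rule eigenspaces_near_regular_zero[OF annihilates ab(2) abD(1,2)])
    then have "infinite (?N - {(z, w). cmod z < 1 \<and> eval2 P z w = 0 \<and> eval2 \<Delta> z w = 0})"
      using inner_toral_finite_common_zeros[OF P toral nd] by (simp add: Diff_infinite_finite)
    then have "?N - {(z, w). cmod z < 1 \<and> eval2 P z w = 0 \<and> eval2 \<Delta> z w = 0} \<noteq> {}"
      using infinite_imp_nonempty by blast
    then obtain z w where zw: "(z, w) \<in> U" "eval2 p z w = 0"
      "complex_vector.dim (joint_eigenspace S T a b) \<le> complex_vector.dim (joint_eigenspace S T z w)"
      "\<not> (cmod z < 1 \<and> eval2 P z w = 0 \<and> eval2 \<Delta> z w = 0)"
      by blast
    then have "eval2 \<Delta> z w \<noteq> 0" "cmod z < 1"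
      by (auto simp: U_def p eval2_mult)
    then have "complex_vector.dim (joint_eigenspace S T z w) \<le> dim x"
      using \<Delta>(2) by (meson not_le)
    then show "complex_vector.dim (joint_eigenspace S T a b) \<le> dim x"
      using zw(3) by simp
  qed
  ultimately show thesis
    using that by blast
qed

end

theorem proposition1p2:
  fixes S T :: "'a::complex_hilbert_space \<Rightarrow> 'a"
    and p :: bipoly and P :: "nat \<Rightarrow> bipoly" and s :: nat
  assumes "pure_poly_isopair p S T"
    and "finite_bimultiplicity S T"
    and "minimal_polynomial p S T"
    and "p = (\<Prod>j=1..s. P j)"
    and "inj_on P {1..s}"
    and "\<And>j. j \<in> {1..s} \<Longrightarrow> irreducible (P j)"
  shows "\<forall>j\<in>{1..s}. \<exists>d::nat. d \<noteq> 0 \<and>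
           (\<forall>(a, b) \<in> inner_variety (P j) \<inter> regular_points p.
              cdim (ker (cadjoint (\<lambda>x. S x - a *\<^sub>C x)) \<inter> ker (cadjoint (\<lambda>x. T x - b *\<^sub>C x)))
                = enat d)"
proof
  fix j
  assume j: "j \<in> {1..s}"
  have finite_kernel: "\<exists>F. finite F \<and> ker (cadjoint A) \<subseteq> complex_vector.span F"
    if "mult A \<noteq> \<infinity>" for A :: "'a \<Rightarrow> 'a"
    using that unfolding mult_def cdim_def by presburger
  interpret finite_isopair S T
  proof
    show "pure_isometry S" "pure_isometry T" "S (T x) = T (S x)" for x
      using assms(1) by (auto simp: pure_poly_isopair_def pure_isopair_def fun_eq_iff)
  qed (use assms(2) finite_kernel in \<open>auto simp: finite_bimultiplicity_def\<close>)
  have "p = P j * (\<Prod>k\<in>{1..s} - {j}. P k)"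
    using j by (simp add: assms(4) prod.remove)
  then obtain d where d: "d \<noteq> 0" "\<And>a b. (a, b) \<in> inner_variety (P j) \<Longrightarrow> (a, b) \<in> regular_points p \<Longrightarrow>
      complex_vector.dim (joint_eigenspace S T a b) = d"
    using regular_dimension_constant[OF assms(3) assms(6)[OF j]] by metis
  have "cmod a < 1" if "(a, b) \<in> inner_variety (P j)" for a b
    using that by (auto simp: inner_variety_def)
  then show "\<exists>d::nat. d \<noteq> 0 \<and>
           (\<forall>(a, b) \<in> inner_variety (P j) \<inter> regular_points p.
              cdim (ker (cadjoint (\<lambda>x. S x - a *\<^sub>C x)) \<inter> ker (cadjoint (\<lambda>x. T x - b *\<^sub>C x)))
                = enat d)"
    using d by (intro exI[of _ d])
      (auto simp: joint_eigenspace_eq_ker[OF isometries] cdim_joint_eigenspace)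
qed

end
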